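(* Let $\delta:=\overline x-\underline x$. Assume $u^*\in\mathcal U^0$. Then, for the sequences generated by the adaptive-breakpoint CPM described in the context, for every $k\ge 0$ and every $u\in\mathcal U^k$, $$d_K(u^*,u)\le d_I(u^*,u)\le\frac{\delta L h_k}{2}+2\delta\sqrt{N_k-1}\;r(\mathcal B^{k,0})\le\frac{\delta Lh_k}{2}+2\delta\sqrt{N_k-1}\left[\epsilon^k r(\mathcal B^{0,0})+L\sum_{i=0}^{k-1}\epsilon^i h_{k-1-i}\right],$$ and $\sup_{u\in\mathcal U^k}\|u-u^*\|_\infty\to0$ as $k\to\infty$.
   Context: **Utilities.** $[\underline x,\overline x]$ is a compact interval, $L>0$, and $\mathcal U_L$ is the set of nondecreasing $u:[\underline x,\overline x]\to[0,1]$ with $u(\underline x)=0$, $u(\overline x)=1$, $|u(x)-u(y)|\le L|x-y|$. The true utility is $u^*\in\mathcal U_L$. **Distances.** For $u,v$ normalized and nondecreasing: $d_K(u,v)=\sup_\varphi\left[\int_{\underline x}^{\overline x}\varphi\,du-\int_{\underline x}^{\overline x}\varphi\,dv\right]$ over all 1-Lipschitz $\varphi:[\underline x,\overline x]\to\mathbb R$ (Kantorovich distance), and $d_I(u,v)=(\overline x-\underline x)\|u-v\|_\infty$ (scaled Kolmogorov distance). **Grids and increments.** $R\mathbf y=(\mathbf y,1-\mathbf e^\top\mathbf y)$ appends a last component making the components sum to 1. A grid $\mathcal X^k=\{x^k_1<\dots<x^k_{N_k+1}\}$ has $x_1^k=\underline x$, $x^k_{N_k+1}=\overline x$, mesh size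 $h_k=\max_{1\le i\le N_k}(x_{i+1}^k-x_i^k)$. For $u\in\mathcal U_L$, $\Pi_k(u)=(u(x_2^k)-u(x_1^k),\dots,u(x_{N_k}^k)-u(x_{N_k-1}^k))^\top\in\mathbb R^{N_k-1}$. The basis mapping $\mathbf g^k:[\underline x,\overline x]\to\mathbb R^{N_k}$ is $\mathbf g^k(x_1^k)=0$ and $\mathbf g^k(x)=(1,\dots,1,\frac{x-x_i^k}{x_{i+1}^k-x_i^k},0,\dots,0)^\top$ (with $i-1$ ones) for $x\in(x_i^k,x_{i+1}^k]$. The minimum enclosing ball (MEB) of a bounded set is the smallest-radius closed Euclidean ball containing it; $r(\cdot)$ denotes radius. **Adaptive-breakpoint CPM** (inner precision $\epsilon\in(0,1)$; run for all rounds $k=0,1,2,\dots$). The initial grid $\mathcal X^0$ has $N_0\ge3$ intervals and $\mathcal P^{0,0}=\{\mathbf v\in\mathbb R^{N_0-1}:0\le(R\mathbf v)_i\le L(x^0_{i+1}-x^0_i),\ i=1,\dots,N_0,\ \mathbf e^\top(R\mathbf v)\le1\}$. In round $k$, starting from $\mathcal P^{k,0}\subset\mathbb R^{N_k-1}$: (1) Inner iterations. Perform major iterations $j=0,1,\dots,M_k-1$, the $j$-th transforming $\mathcal P^{k,j}$ into $\mathcal P^{k,j+1}$: let $\mathbf c$ be the center of the MEB of $\mathcal P^{k,j}$, choose an orthonormal basis $\boldsymbol\alpha^1,\dots,\boldsymbol\alpha^{N_k-1}$ of $\mathbb R^{N_k-1}$, and for each $i=1,\dots,N_k-1$ ask a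 query consisting of two lotteries $A=(\mathbf r,\mathbf p^A)$, $B=(\mathbf r,\mathbf p^B)$ with outcomes $r_0=x_1^k$, $r_s=x_{s+1}^k$ ($s=1,\dots,N_k$) and probability vectors chosen so that, for some $\gamma>0$, $(R\mathbf v)^\top\big(\sum_s(p^A_s-p^B_s)\mathbf g^k(r_s)\big)=\gamma(\boldsymbol\alpha^i)^\top(\mathbf v-\mathbf c)$ for all $\mathbf v$. The decision maker answers without error: $\mu^i=-1$ if $\sum_sp_s^Au^*(r_s)\ge\sum_sp^B_su^*(r_s)$, $\mu^i=1$ otherwise, and the polyhedron is intersected with $\{\mathbf v:\mu^i(\boldsymbol\alpha^i)^\top(\mathbf v-\mathbf c)\le0\}$. With $\mathcal B^{k,j}$ the MEB of $\mathcal P^{k,j}$, the number $M_k$ is such that $r(\mathcal B^{k,M_k})\le\epsilon\,r(\mathcal B^{k,0})$. Put $\mathcal P^{k,+}=\mathcal P^{k,M_k}$. (2) Refinement. Choose $j_k\in\arg\max_{1\le i\le N_k}(x_{i+1}^k-x_i^k)$ and set $\mathcal X^{k+1}=\mathcal X^k\cup\{(x^k_{j_k}+x^k_{j_k+1})/2\}$, so $N_{k+1}=N_k+1$. (3) Lift. With $\widehat{\mathcal P}^{k,+}=\{R\mathbf v:\mathbf v\in\mathcal P^{k,+}\}\subset\mathbb R^{N_k}$, let $\widehat{\mathcal P}^{k+1,0}$ be the set of all $(v_1,\dots,v_{j_k-1},a,v_{j_k}-a,v_{j_k+1},\dots,v_{N_k})^\top\in\mathbb R^{N_k+1}$ with $(v_1,\dots,v_{N_k})^\top\in\widehat{\mathcal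 P}^{k,+}$, $0\le a\le v_{j_k}$, $a\le Lh_k/2$, $v_{j_k}-a\le Lh_k/2$; and $\mathcal P^{k+1,0}=\{\mathbf v\in\mathbb R^{N_k}:R\mathbf v\in\widehat{\mathcal P}^{k+1,0}\}$. **Ambiguity sets.** $\mathcal U^k=\{u\in\mathcal U_L:\Pi_k(u)\in\mathcal P^{k,0}\}$. *)

theory Defs
  imports "HOL-Analysis.Analysis"
begin

text \<open>
  All indices are shifted to start at 0. A vector of dimension \<open>n\<close> is a function
  \<open>nat \<Rightarrow> real\<close> vanishing from index \<open>n\<close> on, i.e. a point of the library's
  \<open>Euclidean_space n\<close>. A utility is a function on the reals of which only the
  values on \<open>{a..b}\<close> matter, where \<open>a\<close> and \<open>b\<close> are the lower and upper end of the
  outcome interval.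
\<close>

abbreviation Rvec :: "nat \<Rightarrow> (nat \<Rightarrow> real) set" where
  "Rvec n \<equiv> topspace (Euclidean_space n)"

definition eball :: "nat \<Rightarrow> (nat \<Rightarrow> real) \<Rightarrow> real \<Rightarrow> (nat \<Rightarrow> real) set" where
  "eball n c r = {v \<in> Rvec n. L2_set (\<lambda>i. v i - c i) {..<n} \<le> r}"

definition is_meb :: "nat \<Rightarrow> (nat \<Rightarrow> real) set \<Rightarrow> (nat \<Rightarrow> real) \<Rightarrow> real \<Rightarrow> bool" where
  "is_meb n S c r \<longleftrightarrow>
     c \<in> Rvec n \<and> 0 \<le> r \<and> S \<subseteq> eball n c r \<and>
     (\<forall>c' \<in> Rvec n. \<forall>r' \<ge> 0. S \<subseteq> eball n c' r' \<longrightarrow> r \<le> r')"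

definition meb :: "nat \<Rightarrow> (nat \<Rightarrow> real) set \<Rightarrow> (nat \<Rightarrow> real) \<times> real" where
  "meb n S = (THE B. is_meb n S (fst B) (snd B))"

abbreviation meb_center :: "nat \<Rightarrow> (nat \<Rightarrow> real) set \<Rightarrow> nat \<Rightarrow> real" where
  "meb_center n S \<equiv> fst (meb n S)"

abbreviation meb_radius :: "nat \<Rightarrow> (nat \<Rightarrow> real) set \<Rightarrow> real" where
  "meb_radius n S \<equiv> snd (meb n S)"

definition utilities :: "real \<Rightarrow> real \<Rightarrow> real \<Rightarrow> (real \<Rightarrow> real) set" where
  "utilities a b L =
     {u. u ` {a..b} \<subseteq> {0..1} \<and> mono_on {a..b} u \<and> u a = 0 \<and> u b = 1 \<and> L-lipschitz_on {a..b} u}"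

text \<open>
  \<open>interval_measure\<close> expects a right-continuous nondecreasing function on the whole line. The
  extension below takes right limits (written as infima, by monotonicity) on \<open>[a, b)\<close> and is
  constant outside, so that integrating a continuous function over \<open>{a..b}\<close> gives its
  Riemann-Stieltjes integral against any nondecreasing \<open>u\<close>; possible jumps of \<open>u\<close> at the end
  points become atoms there. If \<open>u\<close> is continuous, the extension agrees with \<open>u\<close> on \<open>{a..b}\<close>.
\<close>

definition stieltjes_extension :: "real \<Rightarrow> real \<Rightarrow> (real \<Rightarrow> real) \<Rightarrow> real \<Rightarrow> real" where
  "stieltjes_extension a b u x =
     (if x < a then u a else if b \<le> x then u b else (INF y\<in>{x<..b}. u y))"

definition stieltjes_integral :: "real \<Rightarrow> real \<Rightarrow> (real \<Rightarrow> real) \<Rightarrow> (real \<Rightarrow> real) \<Rightarrow> real" where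
  "stieltjes_integral a b \<phi> u = (LINT x:{a..b}|interval_measure (stieltjes_extension a b u). \<phi> x)"

definition kantorovich_dist :: "real \<Rightarrow> real \<Rightarrow> (real \<Rightarrow> real) \<Rightarrow> (real \<Rightarrow> real) \<Rightarrow> real" where
  "kantorovich_dist a b u v =
     (SUP \<phi> \<in> {\<phi>. 1-lipschitz_on {a..b} \<phi>}. stieltjes_integral a b \<phi> u - stieltjes_integral a b \<phi> v)"

definition sup_dist :: "real \<Rightarrow> real \<Rightarrow> (real \<Rightarrow> real) \<Rightarrow> (real \<Rightarrow> real) \<Rightarrow> real" where
  "sup_dist a b u v = (SUP x\<in>{a..b}. \<bar>u x - v x\<bar>)"

definition kolmogorov_dist :: "real \<Rightarrow> real \<Rightarrow> (real \<Rightarrow> real) \<Rightarrow> (real \<Rightarrow> real) \<Rightarrow> real" where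
  "kolmogorov_dist a b u v = (b - a) * sup_dist a b u v"

definition is_grid :: "real \<Rightarrow> real \<Rightarrow> real set \<Rightarrow> bool" where
  "is_grid a b X \<longleftrightarrow> finite X \<and> 2 \<le> card X \<and> Min X = a \<and> Max X = b"

definition intervals :: "real set \<Rightarrow> nat" where
  "intervals X = card X - 1"

text \<open>The points of \<open>X\<close> in increasing order are \<open>gpoint X 0, \<dots>, gpoint X (intervals X)\<close>.\<close>

definition gpoint :: "real set \<Rightarrow> nat \<Rightarrow> real" where
  "gpoint X i = sorted_list_of_set X ! i"

definition glen :: "real set \<Rightarrow> nat \<Rightarrow> real" where
  "glen X i = gpoint X (Suc i) - gpoint X i"

definition mesh :: "real set \<Rightarrow> real" where
  "mesh X = Max (glen X ` {..<intervals X})"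

definition append_last :: "nat \<Rightarrow> (nat \<Rightarrow> real) \<Rightarrow> nat \<Rightarrow> real" where
  "append_last n y i = (if i < n then y i else if i = n then 1 - (\<Sum>l<n. y l) else 0)"

definition increments :: "real set \<Rightarrow> (real \<Rightarrow> real) \<Rightarrow> nat \<Rightarrow> real" where
  "increments X u i =
     (if i < intervals X - 1 then u (gpoint X (Suc i)) - u (gpoint X i) else 0)"

text \<open>
  Component \<open>i\<close> of the basis mapping: 1 on the intervals before the half-open one
  \<open>(gpoint X l, gpoint X (Suc l)]\<close> containing \<open>x\<close>, the relative position of \<open>x\<close> for \<open>i = l\<close>,
  and 0 after it; all components are 0 at the left end.
\<close>

definition basis_map :: "real set \<Rightarrow> real \<Rightarrow> nat \<Rightarrow> real" where
  "basis_map X x i =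
     (if intervals X \<le> i then 0
      else if gpoint X (Suc i) < x then 1
      else if gpoint X i < x then (x - gpoint X i) / glen X i
      else 0)"

definition initial_polyhedron :: "real \<Rightarrow> real set \<Rightarrow> (nat \<Rightarrow> real) set" where
  "initial_polyhedron L X = (let N = intervals X in
     {v \<in> Rvec (N - 1).
        (\<forall>i<N. 0 \<le> append_last (N - 1) v i \<and> append_last (N - 1) v i \<le> L * glen X i) \<and>
        (\<Sum>i<N. append_last (N - 1) v i) \<le> 1})"

definition orthonormal_basis :: "nat \<Rightarrow> (nat \<Rightarrow> nat \<Rightarrow> real) \<Rightarrow> bool" where
  "orthonormal_basis n \<alpha> \<longleftrightarrow>
     (\<forall>i<n. \<alpha> i \<in> Rvec n) \<and>
     (\<forall>i<n. \<forall>j<n. (\<Sum>l<n. \<alpha> i l * \<alpha> j l) = (if i = j then 1 else 0))"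

definition prob_vector :: "nat \<Rightarrow> (nat \<Rightarrow> real) \<Rightarrow> bool" where
  "prob_vector N p \<longleftrightarrow> (\<forall>s\<le>N. 0 \<le> p s) \<and> (\<Sum>s\<le>N. p s) = 1"

text \<open>
  The lotteries \<open>pA\<close> and \<open>pB\<close>, both with the grid points as outcomes, realise the hyperplane
  through \<open>c\<close> with normal vector \<open>\<alpha>\<close>.
\<close>

definition valid_query ::
  "real set \<Rightarrow> (nat \<Rightarrow> real) \<Rightarrow> (nat \<Rightarrow> real) \<Rightarrow> (nat \<Rightarrow> real) \<Rightarrow> (nat \<Rightarrow> real) \<Rightarrow> bool" where
  "valid_query X c \<alpha> pA pB \<longleftrightarrow> (let N = intervals X in
     prob_vector N pA \<and> prob_vector N pB \<and>
     (\<exists>\<gamma>>0. \<forall>v \<in> Rvec (N - 1).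
        (\<Sum>i<N. append_last (N - 1) v i * (\<Sum>s\<le>N. (pA s - pB s) * basis_map X (gpoint X s) i))
          = \<gamma> * (\<Sum>i<N - 1. \<alpha> i * (v i - c i))))"

definition answer :: "(real \<Rightarrow> real) \<Rightarrow> real set \<Rightarrow> (nat \<Rightarrow> real) \<Rightarrow> (nat \<Rightarrow> real) \<Rightarrow> real" where
  "answer u X pA pB =
     (if (\<Sum>s\<le>intervals X. pA s * u (gpoint X s)) \<ge> (\<Sum>s\<le>intervals X. pB s * u (gpoint X s))
      then - 1 else 1)"

definition major_iteration ::
  "(real \<Rightarrow> real) \<Rightarrow> real set \<Rightarrow> (nat \<Rightarrow> real) set \<Rightarrow> (nat \<Rightarrow> real) set \<Rightarrow> bool" where
  "major_iteration u X P P' \<longleftrightarrow> (let n = intervals X - 1; c = meb_center n P in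
     \<exists>\<alpha> pA pB. orthonormal_basis n \<alpha> \<and>
       (\<forall>i<n. valid_query X c (\<alpha> i) (pA i) (pB i)) \<and>
       P' = {v \<in> P. \<forall>i<n. answer u X (pA i) (pB i) * (\<Sum>l<n. \<alpha> i l * (v l - c l)) \<le> 0})"

definition split_component :: "nat \<Rightarrow> real \<Rightarrow> (nat \<Rightarrow> real) \<Rightarrow> nat \<Rightarrow> real" where
  "split_component j x v i =
     (if i < j then v i else if i = j then x else if i = Suc j then v j - x else v (i - 1))"

definition lift_polyhedron ::
  "real \<Rightarrow> real set \<Rightarrow> nat \<Rightarrow> (nat \<Rightarrow> real) set \<Rightarrow> (nat \<Rightarrow> real) set" where
  "lift_polyhedron L X j P = (let N = intervals X; h = mesh X in
     {w \<in> Rvec N. append_last N w \<in>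
        {split_component j x v | x v. v \<in> append_last (N - 1) ` P \<and>
           0 \<le> x \<and> x \<le> v j \<and> x \<le> L * h / 2 \<and> v j - x \<le> L * h / 2}})"

text \<open>
  \<open>X k\<close> is the grid of round \<open>k\<close>, \<open>M k\<close> the number of its major iterations and \<open>P k j\<close> its
  polyhedron after \<open>j\<close> of them; \<open>P k j\<close> is irrelevant for \<open>j > M k\<close>. All choices
  (bases, lotteries, refined intervals) are arbitrary subject to the rules.
\<close>

definition cpm_run ::
  "real \<Rightarrow> real \<Rightarrow> real \<Rightarrow> real \<Rightarrow> (real \<Rightarrow> real) \<Rightarrow>
   (nat \<Rightarrow> real set) \<Rightarrow> (nat \<Rightarrow> nat) \<Rightarrow> (nat \<Rightarrow> nat \<Rightarrow> (nat \<Rightarrow> real) set) \<Rightarrow> bool" where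
  "cpm_run a b L \<epsilon> u X M P \<longleftrightarrow>
     is_grid a b (X 0) \<and> 3 \<le> intervals (X 0) \<and> P 0 0 = initial_polyhedron L (X 0) \<and>
     (\<forall>k. (\<forall>j<M k. major_iteration u (X k) (P k j) (P k (Suc j))) \<and>
          meb_radius (intervals (X k) - 1) (P k (M k))
            \<le> \<epsilon> * meb_radius (intervals (X k) - 1) (P k 0) \<and>
          (\<exists>j. is_arg_max (glen (X k)) (\<lambda>i. i < intervals (X k)) j \<and>
               X (Suc k) = insert ((gpoint (X k) j + gpoint (X k) (Suc j)) / 2) (X k) \<and>
               P (Suc k) 0 = lift_polyhedron L (X k) j (P k (M k))))"

definition ambiguity_set ::
  "real \<Rightarrow> real \<Rightarrow> real \<Rightarrow> real set \<Rightarrow> (nat \<Rightarrow> real) set \<Rightarrow> (real \<Rightarrow> real) set" where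
  "ambiguity_set a b L X P = {u \<in> utilities a b L. increments X u \<in> P}"

end

theory Submission
  imports Defs "HOL-Real_Asymp.Real_Asymp"
begin

text \<open>
  The true increments satisfy every answered query and survive the lift, so in round \<open>k\<close> they lie,
  like those of any \<open>u \<in> U k\<close>, in a ball of radius \<open>r k\<close>; by Cauchy-Schwarz the two utilities then
  differ by at most \<open>2 sqrt (N k - 1) r k\<close> on the grid, and between grid points at most
  \<open>L h k / 2\<close> is added because their difference is \<open>L\<close>-Lipschitz. Integration by parts compares the
  Kantorovich and Kolmogorov distances. Splitting a component enlarges an enclosing ball by at most
  \<open>L h k / 2\<close>, so \<open>r (k + 1) \<le> \<epsilon> r k + L h k\<close>. Bisecting longest intervals keeps the grids
  quasi-uniform, whence \<open>h k = O(1 / k)\<close>, then \<open>r k = O(1 / k)\<close> and the error is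
  \<open>O(1 / sqrt k)\<close>.
\<close>

section \<open>Minimum enclosing balls\<close>

text \<open>A ball of radius at most \<open>R\<close> containing \<open>s0\<close> has its center
  within \<open>R\<close> of \<open>s0\<close> in each coordinate. Such enclosing balls therefore
  form a compact set of pairs (center, radius), on which the radius attains its minimum.\<close>

lemma is_meb_exists:
  assumes s0: "s0 \<in> S" and c0: "c0 \<in> Rvec n" and R: "S \<subseteq> eball n c0 R"
  shows "\<exists>c r. is_meb n S c r"
proof -
  have s0n: "s0 \<in> Rvec n" and "L2_set (\<lambda>i. s0 i - c0 i) {..<n} \<le> R"
    using R s0 by (auto simp: eball_def)
  then have R0: "0 \<le> R" by (meson L2_set_nonneg order_trans)
  \<comment> \<open>Coordinates from \<open>n\<close> on are pinned to 0, so the box is a product of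
    compact factors and compact by Tychonoff.\<close>
  define I where "I i = (if i < n then {s0 i - R..s0 i + R} else {0::real})" for i
  define K where "K = Pi\<^sub>E UNIV I"
  have "compactin (product_topology (\<lambda>i. euclidean) (UNIV :: nat set)) K"
    unfolding K_def compactin_PiE by (simp add: I_def)
  then have cK: "compact K" by (simp add: euclidean_product_topology)
  define T where "T = (K \<times> {0..R}) \<inter> (\<Inter>s\<in>S. {p. L2_set (\<lambda>i. s i - fst p i) {..<n} \<le> snd p})"
  have cont: "continuous_on UNIV (\<lambda>p::(nat \<Rightarrow> real) \<times> real. L2_set (\<lambda>i. s i - fst p i) {..<n})" for s
    unfolding L2_set_def
    by (intro continuous_intros continuous_on_product_then_coordinatewise)
  have "closed {p::(nat \<Rightarrow> real) \<times> real. L2_set (\<lambda>i. s i - fst p i) {..<n} \<le> snd p}" for s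
    by (intro closed_Collect_le cont continuous_intros)
  then have cT: "compact T"
    unfolding T_def by (intro compact_Int_closed compact_Times cK closed_INT) auto
  have inT: "(c, \<rho>) \<in> T"
    if c: "c \<in> Rvec n" and S: "S \<subseteq> eball n c \<rho>" and \<rho>: "0 \<le> \<rho>" "\<rho> \<le> R" for c \<rho>
  proof -
    have "c i \<in> I i" for i
    proof (cases "i < n")
      case True
      have "\<bar>s0 i - c i\<bar> \<le> L2_set (\<lambda>i. \<bar>s0 i - c i\<bar>) {..<n}"
        by (rule member_le_L2_set) (use True in auto)
      also have "\<dots> \<le> \<rho>" using S s0 by (auto simp: eball_def L2_set_def)
      finally show ?thesis using True \<rho> by (auto simp: I_def abs_le_iff)
    next
      case False
      then show ?thesis using c by (simp add: I_def topspace_Euclidean_space)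
    qed
    then have "c \<in> K" by (simp add: K_def PiE_iff)
    then show ?thesis using S \<rho> by (auto simp: T_def eball_def)
  qed
  have "T \<noteq> {}" using inT[OF c0 R R0] by auto
  then obtain p where "p \<in> T" "\<forall>q\<in>T. snd p \<le> snd q"
    using continuous_attains_inf[OF cT _ continuous_on_snd[OF continuous_on_id]] by blast
  then obtain c r where cr: "(c, r) \<in> T" and min: "\<And>c' r'. (c', r') \<in> T \<Longrightarrow> r \<le> r'"
    by (metis prod.collapse snd_conv)
  have "c i \<in> I i" for i using cr by (auto simp: T_def K_def)
  then have "c i = 0" if "i \<ge> n" for i using that by (metis I_def linorder_not_less singletonD)
  then have cR: "c \<in> Rvec n"
    by (simp add: topspace_Euclidean_space)
  have rR: "0 \<le> r" "r \<le> R" using cr by (auto simp: T_def)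
  have "is_meb n S c r"
    unfolding is_meb_def
  proof (intro conjI ballI allI impI)
    show "S \<subseteq> eball n c r" using cr R by (auto simp: T_def eball_def)
    \<comment> \<open>Competitors with radius above \<open>R\<close> lie outside \<open>T\<close>
      but are larger anyway, since \<open>r \<le> R\<close>.\<close>
    show "r \<le> r'" if "c' \<in> Rvec n" "0 \<le> r'" "S \<subseteq> eball n c' r'" for c' r'
      using inT[OF that(1,3,2)] min rR by (cases "r' \<le> R") auto
  qed (use cR rR in auto)
  then show ?thesis by blast
qed

text \<open>Two different minimal balls would, by the parallelogram law, leave room for a smaller one
  around the midpoint of their centers.\<close>

lemma is_meb_unique:
  assumes S: "S \<noteq> {}" and 1: "is_meb n S c r" and 2: "is_meb n S c' r'"
  shows "c = c' \<and> r = r'"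
proof -
  have r: "r = r'" using 1 2 by (intro antisym) (auto simp: is_meb_def)
  define m where "m i = (c i + c' i) / 2" for i
  define D where "D = (\<Sum>i<n. (c i - c' i)\<^sup>2)"
  have mR: "m \<in> Rvec n" using 1 2 by (auto simp: is_meb_def m_def topspace_Euclidean_space)
  have D0: "0 \<le> D" by (simp add: D_def sum_nonneg)
  have bound: "(\<Sum>i<n. (s i - m i)\<^sup>2) \<le> r\<^sup>2 - D / 4" if "s \<in> S" for s
  proof -
    have "(\<Sum>i<n. (s i - c i)\<^sup>2) \<le> r\<^sup>2" "(\<Sum>i<n. (s i - c' i)\<^sup>2) \<le> r\<^sup>2"
      using that 1 2 r by (auto simp: is_meb_def eball_def L2_set_def intro!: sqrt_le_D)
    moreover have "(\<Sum>i<n. (s i - m i)\<^sup>2)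
        = (\<Sum>i<n. (s i - c i)\<^sup>2) / 2 + (\<Sum>i<n. (s i - c' i)\<^sup>2) / 2 - D / 4"
      unfolding D_def sum_divide_distrib sum.distrib[symmetric] sum_subtractf[symmetric]
      by (rule sum.cong) (auto simp: m_def power2_eq_square field_simps)
    ultimately show ?thesis by linarith
  qed
  \<comment> \<open>Any point of the nonempty \<open>S\<close> bounds the radicand below by a sum of
    squares, so the candidate radius is a genuine square root.\<close>
  have "0 \<le> r\<^sup>2 - D / 4"
  proof -
    obtain s where "s \<in> S" using S by blast
    from bound[OF this] show ?thesis
      by (rule order_trans[rotated]) (simp add: sum_nonneg)
  qed
  have "S \<subseteq> eball n m (sqrt (r\<^sup>2 - D / 4))"
    using bound 1 by (auto simp: eball_def L2_set_def is_meb_def)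
  then have "r \<le> sqrt (r\<^sup>2 - D / 4)"
    using 1 mR \<open>0 \<le> r\<^sup>2 - D / 4\<close> by (auto simp: is_meb_def)
  then have "r\<^sup>2 \<le> r\<^sup>2 - D / 4"
    using 1 \<open>0 \<le> r\<^sup>2 - D / 4\<close> by (metis is_meb_def power_mono real_sqrt_pow2)
  then have "D = 0" using D0 by simp
  then have "\<forall>i<n. c i = c' i" by (simp add: D_def sum_nonneg_eq_0_iff)
  moreover have "\<forall>i\<ge>n. c i = c' i" using 1 2 by (simp add: is_meb_def topspace_Euclidean_space)
  ultimately have "c = c'" by (intro ext) (meson linorder_not_less)
  with r show ?thesis by blast
qed

text \<open>\<open>meb\<close> is a definite description; existence and uniqueness make it denote
  the minimal ball of a nonempty bounded set.\<close>

lemma is_meb_meb: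
  assumes "S \<noteq> {}" and "c0 \<in> Rvec n" and "S \<subseteq> eball n c0 R"
  shows "is_meb n S (meb_center n S) (meb_radius n S)"
proof -
  obtain c r where cr: "is_meb n S c r" using is_meb_exists assms by (metis ex_in_conv)
  have "meb n S = (c, r)"
    unfolding meb_def
  proof (rule the_equality)
    show "B = (c, r)" if "is_meb n S (fst B) (snd B)" for B
      using is_meb_unique[OF assms(1) that cr] by (simp add: prod_eq_iff)
  qed (simp add: cr)
  with cr show ?thesis by simp
qed

section \<open>Stieltjes integrals and the Kantorovich distance\<close>

text \<open>For continuous \<open>u\<close> the right limits in the extension are plain values,
  which leaves \<open>u\<close> continued by constants.\<close>

lemma stieltjes_extension_continuous:
  assumes "a < b" and u: "mono_on {a..b} u" and c: "continuous_on {a..b} u"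
  shows "stieltjes_extension a b u = (\<lambda>x. u (max a (min b x)))"
proof
  fix x
  show "stieltjes_extension a b u x = u (max a (min b x))"
  proof (cases "x < a \<or> b \<le> x")
    case True
    then show ?thesis using \<open>a < b\<close> by (auto simp: stieltjes_extension_def)
  next
    case False
    then have x: "a \<le> x" "x < b" by auto
    have "(INF y\<in>{x<..b}. u y) = u x"
    proof (rule antisym)
      show "u x \<le> (INF y\<in>{x<..b}. u y)"
        by (rule cINF_greatest) (use x u in \<open>auto simp: monotone_on_def\<close>)
      have bdd: "bdd_below (u ` {x<..b})"
        by (rule bdd_belowI[of _ "u x"]) (use x u in \<open>auto simp: monotone_on_def\<close>)
      have "(u \<longlongrightarrow> u x) (at x within {x..b})"
        using c x by (meson atLeastAtMost_iff atLeastatMost_subset_iff continuous_on_def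
            continuous_on_subset less_imp_le order_refl)
      then have lim: "(u \<longlongrightarrow> u x) (at_right x)"
        using at_within_Icc_at_right[OF x(2)] by simp
      \<comment> \<open>The infimum lies below every value to the right of \<open>x\<close>, and
        these values tend to \<open>u x\<close>.\<close>
      have "eventually (\<lambda>y. (INF y\<in>{x<..b}. u y) \<le> u y) (at_right x)"
        using eventually_at_right_less[of x] eventually_at_right_real[OF x(2)]
        by eventually_elim (auto intro!: cINF_lower bdd)
      then show "(INF y\<in>{x<..b}. u y) \<le> u x"
        by (rule tendsto_lowerbound[OF lim]) simp
    qed
    then show ?thesis using x by (simp add: stieltjes_extension_def)
  qed
qed

text \<open>Continuity of \<open>u\<close> rules out atoms, so including or excluding an end point
  does not change the mass of an interval.\<close>

locale stieltjes =
  fixes a b :: real and u :: "real \<Rightarrow> real" and \<mu> :: "real measure"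
  assumes ab: "a < b" and mono: "mono_on {a..b} u" and cont: "continuous_on {a..b} u"
  defines "\<mu> \<equiv> interval_measure (stieltjes_extension a b u)"
begin

lemma F_mono: "x \<le> y \<Longrightarrow> stieltjes_extension a b u x \<le> stieltjes_extension a b u y"
  unfolding stieltjes_extension_continuous[OF ab mono cont]
  by (rule monotone_onD[OF mono]) (use ab in auto)

lemma F_cont: "continuous_on UNIV (stieltjes_extension a b u)"
  unfolding stieltjes_extension_continuous[OF ab mono cont]
  by (rule continuous_on_compose2[OF cont]) (use ab in \<open>auto intro!: continuous_intros\<close>)

lemma emeasure_Ioc:
  assumes "a \<le> s" "s \<le> t" "t \<le> b"
  shows "emeasure \<mu> {s<..t} = ennreal (u t - u s)"
proof -
  have "emeasure \<mu> {s<..t} = stieltjes_extension a b u t - stieltjes_extension a b u s"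
    unfolding \<mu>_def using F_mono F_cont assms
    by (intro emeasure_interval_measure_Ioc)
      (auto simp: continuous_on_eq_continuous_within continuous_at_imp_continuous_at_within)
  then show ?thesis
    using assms ab by (simp add: stieltjes_extension_continuous[OF ab mono cont])
qed

lemma emeasure_Icc:
  assumes "a \<le> s" "s \<le> t" "t \<le> b"
  shows "emeasure \<mu> {s..t} = ennreal (u t - u s)"
proof -
  have "emeasure \<mu> {s..t} = stieltjes_extension a b u t - stieltjes_extension a b u s"
    unfolding \<mu>_def using F_mono F_cont assms by (intro emeasure_interval_measure_Icc) auto
  then show ?thesis
    using assms ab by (simp add: stieltjes_extension_continuous[OF ab mono cont])
qed

lemma set_integrable_continuous:
  assumes "continuous_on {a..b} \<phi>" "A \<subseteq> {a..b}" "A \<in> sets borel"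
  shows "set_integrable \<mu> A (\<phi> :: real \<Rightarrow> real)"
proof -
  obtain B where B: "\<And>x. x \<in> {a..b} \<Longrightarrow> norm (\<phi> x) \<le> B"
    using compact_continuous_image[OF assms(1)] compact_imp_bounded bounded_iff
    by (metis compact_Icc imageI)
  \<comment> \<open>The inner indicator makes the function measurable on the whole line, the outer
    one confines it to a set of finite measure.\<close>
  have "integrable \<mu> (\<lambda>x. indicator {a..b} x *\<^sub>R (indicator {a..b} x *\<^sub>R \<phi> x))"
  proof (rule integrableI_bounded_set_indicator[where B = B])
    show "(\<lambda>x. indicator {a..b} x *\<^sub>R \<phi> x) \<in> borel_measurable \<mu>"
      using borel_measurable_continuous_on_indicator[OF _ assms(1)] by (simp add: \<mu>_def)
    show "emeasure \<mu> {a..b} < \<infinity>" using emeasure_Icc[of a b] ab by simp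
  qed (use B in \<open>auto simp: \<mu>_def\<close>)
  then have "set_integrable \<mu> {a..b} \<phi>"
    by (simp add: set_integrable_def mult.assoc[symmetric] indicator_inter_arith[symmetric])
  then show ?thesis using assms by (rule_tac set_integrable_subset) (auto simp: \<mu>_def)
qed

text \<open>There is no atom at \<open>a\<close>; this anchors the later induction over partition
  points.\<close>

lemma set_integral_Icc_0: "set_lebesgue_integral \<mu> {a..a} (\<phi> :: real \<Rightarrow> real) = 0"
proof -
  have "{a..a} \<in> null_sets \<mu>" using emeasure_Icc[of a a] ab by (auto simp: \<mu>_def)
  then show ?thesis 
    unfolding set_lebesgue_integral_def
    by (intro integral_eq_zero_AE) (rule eventually_mono[OF AE_not_in], auto)
qed

lemma set_integral_Icc_split:
  assumes "continuous_on {a..b} (\<phi> :: real \<Rightarrow> real)" "a \<le> s" "s \<le> t" "t \<le> b"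
  shows "(LINT x:{a..t}|\<mu>. \<phi> x) = (LINT x:{a..s}|\<mu>. \<phi> x) + (LINT x:{s<..t}|\<mu>. \<phi> x)"
proof -
  have "{a..t} = {a..s} \<union> {s<..t}" using assms by auto
  then show ?thesis
    by (simp only:) (intro set_integral_Un set_integrable_continuous assms; use assms in auto)
qed

text \<open>One term of a Riemann-Stieltjes sum tagged at the right end of the cell: on the cell a
  1-Lipschitz function deviates from its tag value by at most the cell length.\<close>

lemma set_integral_Ioc_approx:
  assumes \<phi>: "1-lipschitz_on {a..b} (\<phi> :: real \<Rightarrow> real)" and st: "a \<le> s" "s \<le> t" "t \<le> b"
  shows "\<bar>(LINT x:{s<..t}|\<mu>. \<phi> x) - \<phi> t * (u t - u s)\<bar> \<le> (t - s) * (u t - u s)"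
proof -
  have c: "continuous_on {a..b} \<phi>" using \<phi> lipschitz_on_continuous_on by blast
  have "emeasure \<mu> {s<..t} \<noteq> \<infinity>" by (simp add: emeasure_Ioc st)
  moreover have "u s \<le> u t" using mono st by (auto simp: monotone_on_def)
  then have "measure \<mu> {s<..t} = u t - u s" by (simp add: measure_def emeasure_Ioc st)
  ultimately have const: "(LINT x:{s<..t}|\<mu>. c) = (u t - u s) * c" for c :: real
    by (subst set_integral_const) (auto simp: \<mu>_def)
  have int: "set_integrable \<mu> {s<..t} \<psi>" if "continuous_on {a..b} \<psi>" for \<psi> :: "real \<Rightarrow> real"
    by (rule set_integrable_continuous[OF that]) (use st in auto)
  have "(LINT x:{s<..t}|\<mu>. \<phi> x) - \<phi> t * (u t - u s) = (LINT x:{s<..t}|\<mu>. \<phi> x - \<phi> t)"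
    by (subst set_integral_diff(2)) (auto simp: const intro!: int c)
  also have "\<bar>\<dots>\<bar> \<le> (LINT x:{s<..t}|\<mu>. \<bar>\<phi> x - \<phi> t\<bar>)"
    using set_integral_norm_bound[OF int, of "\<lambda>x. \<phi> x - \<phi> t"] c by (simp add: continuous_intros)
  also have "\<dots> \<le> (LINT x:{s<..t}|\<mu>. t - s)"
  proof (rule set_integral_mono)
    show "\<bar>\<phi> x - \<phi> t\<bar> \<le> t - s" if "x \<in> {s<..t}" for x
      using lipschitz_onD[OF \<phi>, of x t] that st by (auto simp: dist_real_def)
  qed (auto intro!: int continuous_intros c)
  finally show ?thesis by (simp add: const mult.commute)
qed

end

text \<open>Summation by parts along a uniform partition: \<open>G\<close> grows on each cell by the increment of
  \<open>\<phi> (u - v)\<close>, a term \<open>D\<close> times the cell length, and an error that vanishes in the limit.\<close>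

lemma stieltjes_integral_diff_le:
  assumes "a < b" and u: "mono_on {a..b} u" "continuous_on {a..b} u"
    and v: "mono_on {a..b} v" "continuous_on {a..b} v"
    and ends: "u a = v a" "u b = v b"
    and \<phi>: "1-lipschitz_on {a..b} \<phi>"
    and D: "\<And>x. x \<in> {a..b} \<Longrightarrow> \<bar>u x - v x\<bar> \<le> D"
  shows "stieltjes_integral a b \<phi> u - stieltjes_integral a b \<phi> v \<le> (b - a) * D"
proof -
  define \<mu> where "\<mu> = interval_measure (stieltjes_extension a b u)"
  define \<nu> where "\<nu> = interval_measure (stieltjes_extension a b v)"
  interpret u: stieltjes a b u \<mu> by unfold_locales (use assms \<mu>_def in auto)
  interpret v: stieltjes a b v \<nu> by unfold_locales (use assms \<nu>_def in auto)
  have c: "continuous_on {a..b} \<phi>" using \<phi> lipschitz_on_continuous_on by blast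
  define G where "G t = (LINT x:{a..t}|\<mu>. \<phi> x) - (LINT x:{a..t}|\<nu>. \<phi> x)" for t
  define e where "e = u b - u a + v b - v a"
  have approx: "G b \<le> (b - a) * D + (b - a) / real n * e" if "n > 0" for n :: nat
  proof -
    define q where "q = (b - a) / n"
    define x where "x i = a + real i * q" for i :: nat
    have q: "q > 0" using that \<open>a < b\<close> by (simp add: q_def)
    have xn: "x n = b" using that by (simp add: x_def q_def)
    have dx: "x (Suc i) = x i + q" for i by (simp add: x_def algebra_simps)
    have xb: "a \<le> x i" "x i \<le> b" if "i \<le> n" for i
      using that q xn mult_right_mono[of "real i" "real n" q] by (auto simp: x_def)
    have "G (x i) \<le> \<phi> (x i) * (u (x i) - v (x i)) + D * (x i - a)
        + q * (u (x i) - u a + v (x i) - v a)" if "i \<le> n" for i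
      using that
    proof (induction i)
      case 0
      then show ?case
        using u.set_integral_Icc_0 v.set_integral_Icc_0 ends by (simp add: G_def x_def)
    next
      case (Suc i)
      let ?s = "x i" and ?t = "x (Suc i)"
      have st: "a \<le> ?s" "?s \<le> ?t" "?t \<le> b" using xb[of i] xb[of "Suc i"] Suc q dx by auto
      have "G ?t = G ?s + (LINT x:{?s<..?t}|\<mu>. \<phi> x) - (LINT x:{?s<..?t}|\<nu>. \<phi> x)"
        using u.set_integral_Icc_split[OF c st] v.set_integral_Icc_split[OF c st]
        by (simp add: G_def)
      moreover have "\<bar>(LINT x:{?s<..?t}|\<mu>. \<phi> x) - \<phi> ?t * (u ?t - u ?s)\<bar> \<le> q * (u ?t - u ?s)"
        using u.set_integral_Ioc_approx[OF \<phi> st] dx by simp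
      moreover have "\<bar>(LINT x:{?s<..?t}|\<nu>. \<phi> x) - \<phi> ?t * (v ?t - v ?s)\<bar> \<le> q * (v ?t - v ?s)"
        using v.set_integral_Ioc_approx[OF \<phi> st] dx by simp
      \<comment> \<open>Abel summation, with \<open>w = u - v\<close>: \<open>\<phi> t * (w t - w s)
        = (\<phi> t * w t - \<phi> s * w s) + (\<phi> s - \<phi> t) * w s\<close>. The first bracket
        telescopes; the remaining term is bounded here.\<close>
      moreover have "(\<phi> ?s - \<phi> ?t) * (u ?s - v ?s) \<le> q * D"
      proof -
        have "\<bar>\<phi> ?s - \<phi> ?t\<bar> \<le> q"
          using lipschitz_onD[OF \<phi>, of ?s ?t] st dx q by (auto simp: dist_real_def)
        then have "\<bar>(\<phi> ?s - \<phi> ?t) * (u ?s - v ?s)\<bar> \<le> q * D"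
          unfolding abs_mult by (intro mult_mono D) (use st q in auto)
        then show ?thesis by linarith
      qed
      moreover have "G ?s \<le> \<phi> ?s * (u ?s - v ?s) + D * (?s - a)
          + q * (u ?s - u a + v ?s - v a)"
        using Suc by simp
      ultimately show ?case by (simp add: dx algebra_simps)
    qed
    \<comment> \<open>The boundary term at \<open>b\<close> vanishes because
      \<open>u b = v b\<close>.\<close>
    from this[of n] show ?thesis using ends by (simp add: xn q_def e_def algebra_simps)
  qed
  have "(\<lambda>n. (b - a) * D + (b - a) / real n * e) \<longlonglongrightarrow> (b - a) * D + 0 * e"
    by (intro tendsto_intros lim_const_over_n)
  then have "G b \<le> (b - a) * D + 0 * e"
    by (rule tendsto_lowerbound) (rule eventually_sequentiallyI[of 1], rule approx, auto)
  then show ?thesis by (simp add: G_def \<mu>_def \<nu>_def stieltjes_integral_def)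
qed

lemma sup_dist_upper:
  assumes "u \<in> utilities a b L" "v \<in> utilities a b L" "x \<in> {a..b}"
  shows "\<bar>u x - v x\<bar> \<le> sup_dist a b u v"
  unfolding sup_dist_def
proof (rule cSUP_upper[OF assms(3)], rule bdd_aboveI2)
  show "\<bar>u y - v y\<bar> \<le> 1" if "y \<in> {a..b}" for y
  proof -
    have "u y \<in> {0..1}" "v y \<in> {0..1}" using assms(1,2) that by (simp_all add: utilities_def image_subset_iff)
    then show ?thesis by auto
  qed
qed

text \<open>Utilities are continuous and share their end values, so summation by parts applies to
  every test function, with the supremum distance as \<open>D\<close>.\<close>

lemma kantorovich_le_kolmogorov:
  assumes "a < b" and u: "u \<in> utilities a b L" and v: "v \<in> utilities a b L"
  shows "kantorovich_dist a b u v \<le> kolmogorov_dist a b u v"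
  unfolding kantorovich_dist_def kolmogorov_dist_def
proof (rule cSUP_least)
  show "{\<phi>. 1-lipschitz_on {a..b} \<phi>} \<noteq> ({} :: (real \<Rightarrow> real) set)"
    using lipschitz_on_constant[of "{a..b}" 0] lipschitz_on_le[of 0 _ _ 1] by fastforce
qed (use assms sup_dist_upper[OF u v] in
    \<open>auto intro!: stieltjes_integral_diff_le lipschitz_on_continuous_on simp: utilities_def\<close>)

section \<open>Grids and increments\<close>

lemma gpoint_strict_mono:
  assumes "finite X" "i < j" "j < card X"
  shows "gpoint X i < gpoint X j"
  unfolding gpoint_def
  using sorted_wrt_nth_less[OF strict_sorted_list_of_set[of X], of i j] assms by simp

lemma gpoint_mono:
  assumes "finite X" "i \<le> j" "j < card X"
  shows "gpoint X i \<le> gpoint X j"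
  using gpoint_strict_mono[of X i j] assms by (cases "i = j") auto

lemma gpoint_image: "finite X \<Longrightarrow> gpoint X ` {..<card X} = X"
  using set_sorted_list_of_set[of X] by (auto simp: gpoint_def set_conv_nth)

lemma mesh_eq_glen_arg_max:
  assumes "is_arg_max (glen X) (\<lambda>i. i < intervals X) j"
  shows "mesh X = glen X j"
  unfolding mesh_def using assms by (intro Max_eqI) (auto simp: is_arg_max_linorder)

context
  fixes X :: "real set" and a b :: real
  assumes grid: "is_grid a b X"
begin

lemma card_grid: "card X = Suc (intervals X)" and intervals_pos: "0 < intervals X"
  and finite_grid: "finite X"
  using grid by (auto simp: is_grid_def intervals_def)

lemma gpoint_in: "i \<le> intervals X \<Longrightarrow> gpoint X i \<in> X"
  using gpoint_image[OF finite_grid] card_grid by (metis image_eqI lessThan_iff less_Suc_eq_le)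

lemma gpoint_first: "gpoint X 0 = a" and gpoint_last: "gpoint X (intervals X) = b"
proof -
  have sub: "a \<le> x \<and> x \<le> b" if "x \<in> X" for x
    using grid that by (auto simp: is_grid_def)
  have "X \<noteq> {}" using gpoint_in[of 0] by auto
  then have ends: "a \<in> X" "b \<in> X"
    using grid Min_in[OF finite_grid] Max_in[OF finite_grid] by (auto simp: is_grid_def)
  then obtain i j where "i < card X" "a = gpoint X i" "j < card X" "b = gpoint X j"
    using gpoint_image[OF finite_grid] by (metis imageE lessThan_iff)
  then have "gpoint X 0 \<le> a" "b \<le> gpoint X (intervals X)"
    using gpoint_mono[OF finite_grid] card_grid by auto
  then show "gpoint X 0 = a" "gpoint X (intervals X) = b"
    using sub gpoint_in by (meson antisym le0 order_refl)+
qed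

lemma grid_less: "a < b"
  using gpoint_strict_mono[OF finite_grid, of 0 "intervals X"] intervals_pos card_grid
  by (simp add: gpoint_first gpoint_last)

lemma gpoint_Icc: "i \<le> intervals X \<Longrightarrow> gpoint X i \<in> {a..b}"
  using gpoint_mono[OF finite_grid, of 0 i] gpoint_mono[OF finite_grid, of i "intervals X"] card_grid
  by (simp add: gpoint_first gpoint_last)

lemma glen_pos: "i < intervals X \<Longrightarrow> 0 < glen X i"
  using gpoint_strict_mono[OF finite_grid, of i "Suc i"] card_grid by (simp add: glen_def)

lemma glen_le_mesh: "i < intervals X \<Longrightarrow> glen X i \<le> mesh X"
  unfolding mesh_def by (intro Max_ge) auto

lemma mesh_pos: "0 < mesh X"
  using glen_pos[of 0] glen_le_mesh[of 0] intervals_pos by linarith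

lemma sum_glen: "(\<Sum>i<intervals X. glen X i) = b - a"
  unfolding glen_def by (simp add: sum_lessThan_telescope gpoint_first gpoint_last)

lemma grid_cell:
  assumes "x \<in> {a..b}"
  obtains i where "i < intervals X" "gpoint X i \<le> x" "x \<le> gpoint X (Suc i)"
proof -
  \<comment> \<open>The guard \<open>0 < i\<close> makes the predicate fail at index 0, so a least
    positive index is found even for \<open>x = a\<close>.\<close>
  have "\<exists>k<intervals X. (\<forall>i\<le>k. \<not> (0 < i \<and> x \<le> gpoint X i)) \<and> 0 < Suc k \<and> x \<le> gpoint X (Suc k)"
    using assms intervals_pos by (intro ex_least_nat_less) (auto simp: gpoint_last)
  then obtain k where "k < intervals X" "\<not> (0 < k \<and> x \<le> gpoint X k)" "x \<le> gpoint X (Suc k)"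
    by blast
  then show ?thesis using that[of k] assms gpoint_first by (cases "k = 0") auto
qed

lemma sum_increments:
  "u a = 0 \<Longrightarrow> (\<Sum>i<s. u (gpoint X (Suc i)) - u (gpoint X i)) = (u (gpoint X s) :: real)"
  by (subst sum_lessThan_telescope) (simp add: gpoint_first)

text \<open>The increments of a normalized function sum to 1, so the appended component is exactly
  the increment over the last interval.\<close>

lemma append_last_increments:
  assumes "u a = 0" "u b = 1"
  shows "append_last (intervals X - 1) (increments X u) i =
    (if i < intervals X then u (gpoint X (Suc i)) - u (gpoint X i) else 0)"
proof -
  have "(\<Sum>l<intervals X - 1. increments X u l) = u (gpoint X (intervals X - 1))"
    using sum_increments[of u "intervals X - 1"] assms by (simp add: increments_def)
  moreover have last: "Suc (intervals X - 1) = intervals X" using intervals_pos by simp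
  moreover have "i < intervals X \<longleftrightarrow> i < intervals X - 1 \<or> i = intervals X - 1" using intervals_pos by auto
  moreover have "u (gpoint X (Suc (intervals X - 1))) = 1" by (simp only: last gpoint_last assms)
  ultimately show ?thesis
    by (auto simp: append_last_def increments_def simp del: One_nat_def)
qed

lemma basis_map_gpoint:
  assumes "i < intervals X" "s \<le> intervals X"
  shows "basis_map X (gpoint X s) i = (if i < s then 1 else 0)"
proof -
  have lt: "gpoint X k < gpoint X l \<longleftrightarrow> k < l" if "k \<le> intervals X" "l \<le> intervals X" for k l
    using gpoint_strict_mono[OF finite_grid, of k l] gpoint_mono[OF finite_grid, of l k] that card_grid
    by (metis less_Suc_eq_le not_le)
  \<comment> \<open>Here \<open>s = Suc i\<close>: the point is the right end of interval
    \<open>i\<close>, where the linear piece has reached 1.\<close>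
  have "(gpoint X s - gpoint X i) / glen X i = 1" if "\<not> Suc i < s" "i < s"
  proof -
    have "s = Suc i" using that by simp
    then show ?thesis using glen_pos[OF assms(1)] by (simp add: glen_def)
  qed
  then show ?thesis using assms lt[of "Suc i" s] lt[of i s] by (auto simp: basis_map_def)
qed

section \<open>Queries and the cuts they induce\<close>

text \<open>At grid point \<open>s\<close> the basis map selects the first \<open>s\<close>
  increments, which telescope; interchanging the sums then yields an expected utility.\<close>

lemma sum_increments_basis_map:
  assumes "u a = 0" "u b = 1"
  shows "(\<Sum>i<intervals X. append_last (intervals X - 1) (increments X u) i *
           (\<Sum>s\<le>intervals X. p s * basis_map X (gpoint X s) i))
       = (\<Sum>s\<le>intervals X. p s * u (gpoint X s))" (is "?l = ?r")
proof -
  let ?N = "intervals X" and ?d = "\<lambda>i. u (gpoint X (Suc i)) - u (gpoint X i)"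
  have "?l = (\<Sum>s\<le>?N. \<Sum>i<?N. p s * (if i < s then ?d i else 0))"
    unfolding sum_distrib_left using assms
    by (subst sum.swap)
      (auto intro!: sum.cong simp: append_last_increments basis_map_gpoint simp del: One_nat_def)
  also have "\<dots> = ?r"
  proof (rule sum.cong)
    fix s assume "s \<in> {..?N}"
    then have "{..<?N} \<inter> {i. i < s} = {..<s}" by auto
    then show "(\<Sum>i<?N. p s * (if i < s then ?d i else 0)) = p s * u (gpoint X s)"
      using sum_increments[of u s] assms
      by (simp add: sum_distrib_left[symmetric] sum.If_cases)
  qed simp
  finally show ?thesis .
qed

text \<open>By validity of a query, the expected-utility gap of its lotteries is a positive multiple
  of the offset \<open>z\<close> of the true increments from the hyperplane, so an error-free answer
  keeps their side.\<close>

lemma major_iteration_mem: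
  assumes u: "u a = 0" "u b = 1" and mem: "increments X u \<in> P" and it: "major_iteration u X P P'"
  shows "increments X u \<in> P'"
proof -
  let ?n = "intervals X - 1" and ?N = "intervals X" and ?v = "increments X u"
  define c where "c = meb_center ?n P"
  obtain \<alpha> pA pB where q: "\<forall>i<?n. valid_query X c (\<alpha> i) (pA i) (pB i)"
    and P': "P' = {v \<in> P. \<forall>i<?n. answer u X (pA i) (pB i) * (\<Sum>l<?n. \<alpha> i l * (v l - c l)) \<le> 0}"
    using it unfolding major_iteration_def c_def Let_def by blast
  have "answer u X (pA i) (pB i) * (\<Sum>l<?n. \<alpha> i l * (?v l - c l)) \<le> 0" if "i < ?n" for i
  proof -
    have "?v \<in> Rvec ?n" by (simp add: increments_def topspace_Euclidean_space)
    moreover have "valid_query X c (\<alpha> i) (pA i) (pB i)" using q that by blast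
    ultimately obtain \<gamma> where \<gamma>: "\<gamma> > 0" "(\<Sum>i'<?N. append_last ?n ?v i' *
        (\<Sum>s\<le>?N. (pA i s - pB i s) * basis_map X (gpoint X s) i'))
        = \<gamma> * (\<Sum>l<?n. \<alpha> i l * (?v l - c l))"
      unfolding valid_query_def Let_def by meson
    define z where "z = (\<Sum>l<?n. \<alpha> i l * (?v l - c l))"
    have "\<gamma> * z
        = (\<Sum>s\<le>?N. pA i s * u (gpoint X s)) - (\<Sum>s\<le>?N. pB i s * u (gpoint X s))"
      using \<gamma>(2) unfolding sum_increments_basis_map[OF u] z_def
      by (simp add: left_diff_distrib sum_subtractf)
    \<comment> \<open>Positivity of \<open>\<gamma>\<close> transfers the sign of the gap; a tie
      gives \<open>z = 0\<close>, which the closed half-space retains.\<close>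
    moreover have "0 \<le> \<gamma> * z \<longleftrightarrow> 0 \<le> z" using \<gamma>(1) by (simp add: zero_le_mult_iff)
    ultimately show ?thesis unfolding z_def[symmetric] by (auto simp: answer_def)
  qed
  then show ?thesis using mem by (simp add: P')
qed

section \<open>From increments to the supremum distance\<close>

lemma sup_dist_le_of_increments:
  assumes u: "u \<in> utilities a b L" "increments X u \<in> eball (intervals X - 1) c r"
    and v: "v \<in> utilities a b L" "increments X v \<in> eball (intervals X - 1) c r"
  shows "sup_dist a b u v \<le> L * mesh X / 2 + 2 * sqrt (real (intervals X) - 1) * r"
proof -
  let ?n = "intervals X - 1"
  define w where "w x = u x - v x" for x
  define B where "B = 2 * sqrt (real (intervals X) - 1) * r"
  have n: "real ?n = real (intervals X) - 1" using intervals_pos by simp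
  have L0: "0 \<le> L" using u lipschitz_on_nonneg by (auto simp: utilities_def)
  let ?d = "\<lambda>i. increments X u i - increments X v i"
  have d: "L2_set ?d {..<?n} \<le> 2 * r"
  proof -
    have "L2_set ?d {..<?n} \<le> L2_set (\<lambda>i. increments X u i - c i) {..<?n}
        + L2_set (\<lambda>i. c i - increments X v i) {..<?n}"
      using L2_set_triangle_ineq[of "\<lambda>i. increments X u i - c i" "\<lambda>i. c i - increments X v i"] by simp
    also have "L2_set (\<lambda>i. c i - increments X v i) {..<?n} = L2_set (\<lambda>i. increments X v i - c i) {..<?n}"
      by (simp add: L2_set_def power2_commute)
    finally show ?thesis using u v by (simp add: eball_def)
  qed
  \<comment> \<open>At a grid point \<open>w\<close> is a partial sum of at most \<open>?n\<close>
    differences; Cauchy-Schwarz against the all-ones vector supplies the square root.\<close>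
  have small: "\<bar>w (gpoint X s)\<bar> \<le> B" if "s \<le> ?n" for s
  proof -
    have "w (gpoint X s) = (\<Sum>i<s. ?d i)"
      using sum_increments[of u s] sum_increments[of v s] u v that
      by (simp add: utilities_def increments_def w_def sum_subtractf)
    then have "\<bar>w (gpoint X s)\<bar> \<le> (\<Sum>i<s. \<bar>?d i\<bar>)" by simp
    also have "\<dots> \<le> (\<Sum>i<?n. \<bar>?d i\<bar> * \<bar>1\<bar>)" using that by (auto intro!: sum_mono2)
    also have "\<dots> \<le> L2_set ?d {..<?n} * L2_set (\<lambda>i. 1) {..<?n}" by (rule L2_set_mult_ineq)
    also have "\<dots> \<le> 2 * r * sqrt (real ?n)"
      using d by (auto simp: L2_set_constant intro!: mult_right_mono)
    finally show ?thesis by (simp add: B_def n[symmetric] mult_ac del: of_nat_diff One_nat_def)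
  qed
  then have "0 \<le> B" using abs_ge_zero order_trans by blast
  \<comment> \<open>The last increment is not a component of the vectors, but at \<open>b\<close>
    both utilities equal 1.\<close>
  have node: "\<bar>w (gpoint X s)\<bar> \<le> B" if "s \<le> intervals X" for s
  proof (cases "s = intervals X")
    case True
    then show ?thesis using u v \<open>0 \<le> B\<close> by (simp add: gpoint_last w_def utilities_def)
  qed (use small that in auto)
  \<comment> \<open>Both utilities are nondecreasing, so their increments lie in
    \<open>[0, L * (y - x)]\<close> and differ by at most \<open>L * (y - x)\<close>, not twice
    that.\<close>
  have lip: "\<bar>w x - w y\<bar> \<le> L * (y - x)" if "a \<le> x" "x \<le> y" "y \<le> b" for x y
  proof -
    have "dist (u x) (u y) \<le> L * dist x y" "dist (v x) (v y) \<le> L * dist x y"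
      using u v that by (auto simp: utilities_def intro!: lipschitz_onD[of L "{a..b}"])
    moreover have "u x \<le> u y" "v x \<le> v y" using u v that by (auto simp: utilities_def monotone_on_def)
    ultimately show ?thesis using that by (auto simp: w_def dist_real_def abs_if split: if_splits)
  qed
  show ?thesis
    unfolding sup_dist_def
  proof (rule cSUP_least)
    show "{a..b} \<noteq> {}" using grid_less by simp
    fix x assume x: "x \<in> {a..b}"
    obtain i where i: "i < intervals X" "gpoint X i \<le> x" "x \<le> gpoint X (Suc i)"
      using grid_cell[OF x] .
    \<comment> \<open>Estimating \<open>w x\<close> from both ends of its cell and averaging leaves
      only half the cell length.\<close>
    have "\<bar>w (gpoint X i) - w x\<bar> \<le> L * (x - gpoint X i)" "\<bar>w x - w (gpoint X (Suc i))\<bar> \<le> L * (gpoint X (Suc i) - x)"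
      using i x gpoint_Icc[of i] gpoint_Icc[of "Suc i"] by (auto intro!: lip)
    moreover have "\<bar>w (gpoint X i)\<bar> \<le> B" "\<bar>w (gpoint X (Suc i))\<bar> \<le> B" using i by (auto intro!: node)
    moreover have "L * glen X i \<le> L * mesh X" using glen_le_mesh[OF i(1)] L0 by (rule mult_left_mono)
    moreover have "L * (x - gpoint X i) + L * (gpoint X (Suc i) - x) = L * glen X i"
      by (simp add: glen_def algebra_simps)
    ultimately have "\<bar>w x\<bar> \<le> L * mesh X / 2 + B" by linarith
    then show "\<bar>u x - v x\<bar> \<le> L * mesh X / 2 + 2 * sqrt (real (intervals X) - 1) * r"
      by (simp add: w_def B_def)
  qed
qed

section \<open>Inserting a point into a grid\<close>

text \<open>A strictly sorted list is determined by its set, so it suffices to put \<open>m\<close>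
  between the first \<open>Suc j\<close> points and the rest.\<close>

lemma gpoint_insert:
  assumes j: "j < intervals X" and m: "gpoint X j < m" "m < gpoint X (Suc j)"
    and i: "i \<le> Suc (intervals X)"
  shows "gpoint (insert m X) i =
    (if i \<le> j then gpoint X i else if i = Suc j then m else gpoint X (i - 1))"
proof -
  let ?xs = "sorted_list_of_set X"
  let ?ys = "take (Suc j) ?xs @ m # drop (Suc j) ?xs"
  have len: "length ?xs = Suc (intervals X)" by (simp add: card_grid)
  have st: "sorted_wrt (<) (take (Suc j) ?xs)" "sorted_wrt (<) (drop (Suc j) ?xs)"
    using strict_sorted_list_of_set sorted_wrt_take sorted_wrt_drop by blast+
  have lo: "x < m" if x: "x \<in> set (take (Suc j) ?xs)" for x
  proof -
    from x obtain l where "l < length (take (Suc j) ?xs)" "x = take (Suc j) ?xs ! l"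
      by (metis in_set_conv_nth)
    then have "l \<le> j" "x = gpoint X l" by (auto simp: gpoint_def)
    then show ?thesis using gpoint_mono[OF finite_grid, of l j] j m card_grid by simp
  qed
  have hi: "m < x" if x: "x \<in> set (drop (Suc j) ?xs)" for x
  proof -
    from x obtain l where "l < length (drop (Suc j) ?xs)" "x = drop (Suc j) ?xs ! l"
      by (metis in_set_conv_nth)
    then have "Suc j + l < card X" "x = gpoint X (Suc j + l)"
      using j by (auto simp: gpoint_def card_grid)
    then show ?thesis using gpoint_mono[OF finite_grid, of "Suc j" "Suc j + l"] m by simp
  qed
  have "sorted_wrt (<) ?ys"
    using st lo hi by (fastforce simp: sorted_wrt_append)
  moreover have "set ?ys = insert m X"
    using finite_grid by (metis append_take_drop_id list.simps(15) set_append set_sorted_list_of_set Un_insert_right)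
  ultimately have eq: "sorted_list_of_set (insert m X) = ?ys"
    using strict_sorted_equal[OF strict_sorted_list_of_set] finite_grid by (metis finite.insertI set_sorted_list_of_set)
  show ?thesis
  proof -
    have take: "length (take (Suc j) ?xs) = Suc j" using j len by simp
    consider "i \<le> j" | "i = Suc j" | k where "i = Suc (Suc j + k)"
      by (metis less_imp_Suc_add linorder_neqE_nat not_le not_less_eq add_Suc)
    then show ?thesis
      by cases (use i j eq take len in \<open>simp_all add: gpoint_def nth_append\<close>)
  qed
qed

lemma
  assumes j: "j < intervals X" and m: "gpoint X j < m" "m < gpoint X (Suc j)"
  shows is_grid_insert: "is_grid a b (insert m X)"
    and intervals_insert: "intervals (insert m X) = Suc (intervals X)"
proof -
  have "m \<notin> X"
  proof
    assume "m \<in> X"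
    then obtain i where i: "i \<le> intervals X" "m = gpoint X i"
      using gpoint_image[OF finite_grid] card_grid by (metis imageE lessThan_iff less_Suc_eq_le)
    then have "i \<le> j \<or> Suc j \<le> i" by auto
    then show False
      using i m j gpoint_mono[OF finite_grid, of i j] gpoint_mono[OF finite_grid, of "Suc j" i] card_grid by auto
  qed
  then show iv: "intervals (insert m X) = Suc (intervals X)"
    using finite_grid card_grid by (simp add: intervals_def)
  have "m \<in> {a..b}" using gpoint_Icc[of j] gpoint_Icc[of "Suc j"] j m by auto
  then show "is_grid a b (insert m X)"
    using grid finite_grid \<open>m \<notin> X\<close> gpoint_in[of 0] Min_insert[of X m] Max_insert[of X m]
    by (auto simp: is_grid_def simp del: Min_insert Max_insert)
qed

text \<open>Arbitrary \<open>f\<close> covers both utility increments and, with the identity,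
  interval lengths.\<close>

lemma increments_insert:
  fixes f :: "real \<Rightarrow> real"
  assumes "j < intervals X" "gpoint X j < m" "m < gpoint X (Suc j)" "i \<le> intervals X"
  shows "f (gpoint (insert m X) (Suc i)) - f (gpoint (insert m X) i) =
    split_component j (f m - f (gpoint X j)) (\<lambda>i. f (gpoint X (Suc i)) - f (gpoint X i)) i"
  using assms gpoint_insert[OF assms(1-3), of i] gpoint_insert[OF assms(1-3), of "Suc i"]
  by (auto simp: split_component_def)

end

section \<open>Enclosing balls under the lift\<close>

text \<open>Splitting amounts to inserting a zero at position \<open>j\<close>, which preserves the
  norm, and then adding \<open>y\<close> there and \<open>- y\<close> at the next position.\<close>

lemma L2_set_split_component_le:
  assumes "j \<le> n"
  shows "L2_set (split_component j y d) {..<Suc n} \<le> L2_set d {..<n} + 2 * \<bar>y\<bar>"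
proof -
  let ?e = "\<lambda>i. y * ((if i = j then 1 else 0) - (if i = Suc j then 1 else 0))"
  have "L2_set (split_component j y d) {..<Suc n} = L2_set (\<lambda>i. split_component j 0 d i + ?e i) {..<Suc n}"
    by (rule L2_set_cong) (auto simp: split_component_def)
  also have "\<dots> \<le> L2_set (split_component j 0 d) {..<Suc n} + L2_set ?e {..<Suc n}"
    by (rule L2_set_triangle_ineq)
  \<comment> \<open>Induction on \<open>n\<close> from \<open>j\<close>. In the base case the
    position \<open>Suc j\<close> is already out of range; it is the split of the appended last
    component.\<close>
  also have "(\<Sum>i<Suc n. (split_component j 0 d i)\<^sup>2) = (\<Sum>i<n. (d i)\<^sup>2)"
    using assms
  proof (induction rule: dec_induct)
    case base
    then show ?case by (simp add: split_component_def)
  next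
    case (step n)
    then show ?case by (simp add: split_component_def)
  qed
  then have "L2_set (split_component j 0 d) {..<Suc n} = L2_set d {..<n}" by (simp add: L2_set_def)
  also have "L2_set ?e {..<Suc n} \<le> 2 * \<bar>y\<bar>"
  proof -
    have "L2_set ?e {..<Suc n} \<le> (\<Sum>i<Suc n. \<bar>?e i\<bar>)" by (rule L2_set_le_sum_abs)
    also have "\<dots> \<le> (\<Sum>i<Suc n. (if i = j then \<bar>y\<bar> else 0) + (if i = Suc j then \<bar>y\<bar> else 0))"
      by (rule sum_mono) auto
    also have "\<dots> \<le> 2 * \<bar>y\<bar>" by (subst sum.distrib) (simp add: sum.delta)
    finally show ?thesis .
  qed
  finally show ?thesis by simp
qed

text \<open>The two halves of the split interval carry increments in \<open>[0, L h / 2]\<close>; the new center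
  gives the left one the midpoint \<open>L h / 4\<close> of this range and the right one the rest of \<open>c j\<close>.\<close>

lemma lift_polyhedron_enclosed:
  assumes j: "j < intervals X" and P: "P \<subseteq> eball (intervals X - 1) c \<rho>"
  shows "\<exists>c'\<in>Rvec (intervals X). lift_polyhedron L X j P \<subseteq> eball (intervals X) c' (\<rho> + L * mesh X / 2)"
proof -
  define t where "t = L * mesh X / 4"
  define c' where "c' i = (if i < intervals X then split_component j t c i else 0)" for i
  obtain n where n: "intervals X = Suc n" using j by (cases "intervals X") auto
  have "w \<in> eball (intervals X) c' (\<rho> + L * mesh X / 2)" if w: "w \<in> lift_polyhedron L X j P" for w
  proof -
    from w obtain x v where wR: "w \<in> Rvec (intervals X)" and v: "v \<in> P"
      and eq: "append_last (Suc n) w = split_component j x (append_last n v)"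
      and x: "0 \<le> x" "x \<le> L * mesh X / 2"
      unfolding lift_polyhedron_def Let_def by (auto simp: n)
    \<comment> \<open>Splitting is linear in the first part and the vector jointly. For
      \<open>j = n\<close> the appended component would enter only at \<open>Suc j\<close>, outside
      the range.\<close>
    have "w i - c' i = split_component j (x - t) (\<lambda>i. v i - c i) i" if "i < Suc n" for i
    proof -
      have "w i = split_component j x (append_last n v) i"
        using fun_cong[OF eq, of i] that by (simp add: append_last_def)
      then show ?thesis
        using that j by (auto simp: c'_def n split_component_def append_last_def)
    qed
    then have "L2_set (\<lambda>i. w i - c' i) {..<Suc n}
        = L2_set (split_component j (x - t) (\<lambda>i. v i - c i)) {..<Suc n}"
      by (intro L2_set_cong) auto
    also have "\<dots> \<le> L2_set (\<lambda>i. v i - c i) {..<n} + 2 * \<bar>x - t\<bar>"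
      using j by (intro L2_set_split_component_le) (simp add: n)
    also have "\<dots> \<le> \<rho> + L * mesh X / 2"
    proof -
      have "x \<le> 2 * t" using x by (simp add: t_def)
      then have "\<bar>x - t\<bar> \<le> t" using x by linarith
      then have "2 * \<bar>x - t\<bar> \<le> L * mesh X / 2" by (simp add: t_def)
      moreover have "L2_set (\<lambda>i. v i - c i) {..<n} \<le> \<rho>" using P v by (auto simp: eball_def n)
      ultimately show ?thesis by linarith
    qed
    finally show ?thesis using wR by (simp add: eball_def n)
  qed
  moreover have "c' \<in> Rvec (intervals X)" by (simp add: c'_def topspace_Euclidean_space)
  ultimately show ?thesis by blast
qed

text \<open>The Euclidean norm is at most the sum of the nonnegative components. The ball shows
  boundedness, from which minimum enclosing balls exist in all rounds.\<close>

lemma initial_polyhedron_enclosed: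
  "initial_polyhedron L X \<subseteq> eball (intervals X - 1) (\<lambda>_. 0) (\<Sum>i<intervals X - 1. L * glen X i)"
proof
  fix v assume v: "v \<in> initial_polyhedron L X"
  have comp: "0 \<le> v i \<and> v i \<le> L * glen X i" if "i < intervals X - 1" for i
    using v that unfolding initial_polyhedron_def Let_def append_last_def
    by (auto dest!: spec[of _ i])
  have "L2_set v {..<intervals X - 1} \<le> (\<Sum>i<intervals X - 1. v i)"
    using comp by (intro L2_set_le_sum) auto
  also have "\<dots> \<le> (\<Sum>i<intervals X - 1. L * glen X i)"
    using comp by (intro sum_mono) auto
  finally show "v \<in> eball (intervals X - 1) (\<lambda>_. 0) (\<Sum>i<intervals X - 1. L * glen X i)"
    using v by (auto simp: eball_def initial_polyhedron_def Let_def)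
qed

section \<open>A contraction with harmonic forcing\<close>

text \<open>Induction with the shifted bound \<open>D / (real k + A)\<close>: the shift slows its
  relative decay below the contraction rate, with room left for the forcing.\<close>

lemma contraction_with_harmonic_forcing:
  fixes r :: "nat \<Rightarrow> real"
  assumes \<epsilon>: "0 < \<epsilon>" "\<epsilon> < 1" and B: "0 \<le> B"
    and step: "\<And>k. r (Suc k) \<le> \<epsilon> * r k + B / (real k + 1)"
  shows "\<exists>D. \<forall>k. r k \<le> D / (real k + 1)"
proof -
  define A where "A = 1 + 2 * \<epsilon> / (1 - \<epsilon>)"
  \<comment> \<open>The first entry serves the base case, the second makes \<open>A * B\<close> at
    most a quarter of \<open>D * (1 - \<epsilon>)\<close>.\<close>
  define D where "D = max (A * \<bar>r 0\<bar>) (4 * A * B / (1 - \<epsilon>))"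
  have A1: "1 \<le> A" using \<epsilon> by (simp add: A_def)
  have "A * (1 - \<epsilon>) = 1 + \<epsilon>" using \<epsilon> by (simp add: A_def field_simps)
  then have A: "\<epsilon> \<le> A * (1 - \<epsilon>) / 2" using \<epsilon> by simp
  have D0: "0 \<le> D" using A1 by (auto simp: D_def le_max_iff_disj)
  have "4 * A * B / (1 - \<epsilon>) \<le> D" by (simp add: D_def)
  then have D: "A * B \<le> D * (1 - \<epsilon>) / 4" using \<epsilon> by (simp add: field_simps)
  have "r k \<le> D / (real k + A)" for k
  proof (induction k)
    case 0
    have "A * r 0 \<le> D" using A1 by (auto simp: D_def le_max_iff_disj intro!: mult_left_mono)
    then show ?case using A1 by (simp add: field_simps)
  next
    case (Suc k)
    define t where "t = real k + A"
    have t: "A \<le> t" "1 \<le> t" using A1 by (auto simp: t_def)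
    have "t \<le> A * (real k + 1)" using A1 mult_right_mono[of 1 A "real k"] by (simp add: t_def algebra_simps)
    then have "B * t \<le> B * (A * (real k + 1))" using B by (rule mult_left_mono)
    then have "B / (real k + 1) \<le> A * B / t" using t by (simp add: field_simps)
    moreover have "\<epsilon> * r k \<le> \<epsilon> * D / t"
      using mult_left_mono[OF Suc, of \<epsilon>] \<epsilon> by (simp add: t_def)
    ultimately have "r (Suc k) \<le> (\<epsilon> * D + A * B) / t"
      using step[of k] by (simp add: add_divide_distrib)
    also have "\<dots> \<le> D / (t + 1)"
    proof -
      \<comment> \<open>The slack \<open>t * (1 - \<epsilon>) * D\<close> is halved: one half
        absorbs \<open>\<epsilon> * D\<close> by the choice of \<open>A\<close>, the other absorbs
        \<open>A * B * (t + 1)\<close> because \<open>t + 1 \<le> 2 * t\<close>.\<close>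
      have "A * (1 - \<epsilon>) \<le> t * (1 - \<epsilon>)" using t \<epsilon> by (intro mult_right_mono) auto
      then have "\<epsilon> * D \<le> t * (1 - \<epsilon>) / 2 * D"
        using A D0 by (intro mult_right_mono) linarith+
      moreover have "A * B * (t + 1) \<le> D * (1 - \<epsilon>) / 4 * (2 * t)"
        using D t A1 B D0 \<epsilon> by (intro mult_mono) auto
      ultimately have "(\<epsilon> * D + A * B) * (t + 1) \<le> D * t" by (simp add: algebra_simps)
      then show ?thesis using t by (simp add: field_simps)
    qed
    finally show ?case by (simp add: t_def add_ac)
  qed
  moreover have "D / (real k + A) \<le> D / (real k + 1)" for k
    using A1 D0 by (intro divide_left_mono) auto
  ultimately show ?thesis by (meson order_trans)
qed

section \<open>Runs of the algorithm\<close>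

lemma mesh_le_of_quasiuniform:
  assumes grid: "is_grid a b X" and \<kappa>: "0 < \<kappa>" "\<And>i. i < intervals X \<Longrightarrow> \<kappa> * mesh X \<le> glen X i"
  shows "mesh X \<le> (b - a) / \<kappa> / real (intervals X)"
proof -
  have "real (intervals X) * (\<kappa> * mesh X) \<le> (\<Sum>i<intervals X. glen X i)"
    using sum_mono[of "{..<intervals X}" "\<lambda>_. \<kappa> * mesh X"] \<kappa> by simp
  then show ?thesis
    using \<kappa> intervals_pos[OF grid] by (simp add: sum_glen[OF grid] field_simps)
qed

locale cpm =
  fixes a b L \<epsilon> :: real and u :: "real \<Rightarrow> real" and X :: "nat \<Rightarrow> real set"
    and M :: "nat \<Rightarrow> nat" and P :: "nat \<Rightarrow> nat \<Rightarrow> (nat \<Rightarrow> real) set"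
  assumes L: "0 < L" and \<epsilon>: "0 < \<epsilon>" "\<epsilon> < 1"
    and run: "cpm_run a b L \<epsilon> u X M P"
    and u: "u \<in> utilities a b L" and u0: "increments (X 0) u \<in> P 0 0"
begin

abbreviation "N k \<equiv> intervals (X k)"
abbreviation "r k \<equiv> meb_radius (N k - 1) (P k 0)"

lemma refinement:
  obtains j where "j < N k" "mesh (X k) = glen (X k) j"
    "X (Suc k) = insert ((gpoint (X k) j + gpoint (X k) (Suc j)) / 2) (X k)"
    "P (Suc k) 0 = lift_polyhedron L (X k) j (P k (M k))"
proof -
  obtain j where j: "is_arg_max (glen (X k)) (\<lambda>i. i < N k) j"
    "X (Suc k) = insert ((gpoint (X k) j + gpoint (X k) (Suc j)) / 2) (X k)"
    "P (Suc k) 0 = lift_polyhedron L (X k) j (P k (M k))"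
    using run unfolding cpm_run_def by blast
  have "j < N k" using j(1) by (simp add: is_arg_max_def)
  then show ?thesis using that[of j] j mesh_eq_glen_arg_max[OF j(1)] by blast
qed

lemma midpoint_between:
  assumes "is_grid a b (X k)" "j < N k"
  shows "gpoint (X k) j < (gpoint (X k) j + gpoint (X k) (Suc j)) / 2"
    "(gpoint (X k) j + gpoint (X k) (Suc j)) / 2 < gpoint (X k) (Suc j)"
  using glen_pos[OF assms] by (simp_all add: glen_def)

lemma grid: "is_grid a b (X k)"
proof (induction k)
  case 0
  then show ?case using run by (simp add: cpm_run_def)
next
  case (Suc k)
  obtain j where "j < N k" "X (Suc k) = insert ((gpoint (X k) j + gpoint (X k) (Suc j)) / 2) (X k)"
    using refinement[of k] .
  then show ?case using is_grid_insert[OF Suc] midpoint_between[OF Suc] by metis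
qed

lemma intervals_Suc: "N (Suc k) = Suc (N k)"
proof -
  obtain j where "j < N k" "X (Suc k) = insert ((gpoint (X k) j + gpoint (X k) (Suc j)) / 2) (X k)"
    using refinement[of k] .
  then show ?thesis using intervals_insert[OF grid] midpoint_between[OF grid] by metis
qed

lemma intervals_eq: "N k = N 0 + k"
  by (induction k) (simp_all add: intervals_Suc)

lemma inner_iterations:
  assumes "increments (X k) u \<in> P k 0" "j \<le> M k"
  shows "increments (X k) u \<in> P k j" "P k j \<subseteq> P k 0"
proof -
  have it: "major_iteration u (X k) (P k i) (P k (Suc i))" if "i < M k" for i
    using run that by (simp add: cpm_run_def)
  have "increments (X k) u \<in> P k j \<and> P k j \<subseteq> P k 0"
    using assms(2)
  proof (induction j)
    case (Suc j)
    have "increments (X k) u \<in> P k (Suc j)"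
      using major_iteration_mem[OF grid _ _ _ it] Suc u by (simp add: utilities_def)
    moreover have "P k (Suc j) \<subseteq> P k j"
      using it[of j] Suc.prems unfolding major_iteration_def Let_def by auto
    ultimately show ?case using Suc by auto
  qed (use assms in simp)
  then show "increments (X k) u \<in> P k j" "P k j \<subseteq> P k 0" by auto
qed

text \<open>The lift imposes only what every utility satisfies: monotonicity bounds the two parts
  below by 0, the Lipschitz condition on each half-interval bounds them above.\<close>

lemma lift_mem:
  assumes j: "j < N k" "mesh (X k) = glen (X k) j"
    and m: "m = (gpoint (X k) j + gpoint (X k) (Suc j)) / 2"
    and X': "X (Suc k) = insert m (X k)" and mem: "increments (X k) u \<in> Q"
  shows "increments (X (Suc k)) u \<in> lift_polyhedron L (X k) j Q"
proof -
  let ?g = "gpoint (X k)"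
  \<comment> \<open>The witness is the utility gain over the left half.\<close>
  define x where "x = u m - u (?g j)"
  have ends: "u a = 0" "u b = 1" using u by (auto simp: utilities_def)
  have btw: "?g j < m" "m < ?g (Suc j)" using midpoint_between[OF grid j(1)] m by auto
  have Icc: "?g j \<in> {a..b}" "?g (Suc j) \<in> {a..b}" "m \<in> {a..b}"
    using gpoint_Icc[OF grid[of k], of j] gpoint_Icc[OF grid[of k], of "Suc j"] j btw by auto
  let ?v = "append_last (N k - 1) (increments (X k) u)"
  have v: "?v i = (if i < N k then u (?g (Suc i)) - u (?g i) else 0)" for i
    by (rule append_last_increments[OF grid ends])
  have "append_last (N k) (increments (X (Suc k)) u) i = split_component j x ?v i" for i
  proof -
    have "append_last (N k) (increments (X (Suc k)) u) i = 
      (if i < Suc (N k) then u (gpoint (X (Suc k)) (Suc i)) - u (gpoint (X (Suc k)) i) else 0)"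
      using append_last_increments[OF grid[of "Suc k"] ends, of i] by (simp add: intervals_Suc)
    also have "\<dots> = (if i < Suc (N k) then
        split_component j x (\<lambda>i. u (?g (Suc i)) - u (?g i)) i else 0)"
      using increments_insert[OF grid j(1) btw, of i u] by (simp add: X' x_def)
    also have "\<dots> = split_component j x ?v i"
      using j by (auto simp: split_component_def v simp del: One_nat_def)
    finally show ?thesis .
  qed
  then have eq: "append_last (N k) (increments (X (Suc k)) u) = split_component j x ?v" by blast
  have mono: "u (?g j) \<le> u m" "u m \<le> u (?g (Suc j))"
    using u Icc btw by (auto simp: utilities_def monotone_on_def)
  have lip: "dist (u s) (u t) \<le> L * dist s t" if "s \<in> {a..b}" "t \<in> {a..b}" for s t
    using u that by (auto simp: utilities_def intro!: lipschitz_onD[of L "{a..b}"])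
  have half: "m - ?g j = mesh (X k) / 2" "?g (Suc j) - m = mesh (X k) / 2"
    using m j by (auto simp: glen_def field_simps)
  have "u m - u (?g j) \<le> L * (m - ?g j)" "u (?g (Suc j)) - u m \<le> L * (?g (Suc j) - m)"
    using lip[OF Icc(1,3)] lip[OF Icc(3,2)] btw by (auto simp: dist_real_def)
  moreover have "?v j = u (?g (Suc j)) - u (?g j)" unfolding v using j by simp
  ultimately have "0 \<le> x" "x \<le> ?v j" "x \<le> L * mesh (X k) / 2" "?v j - x \<le> L * mesh (X k) / 2"
    using mono unfolding half by (simp_all add: x_def del: One_nat_def)
  moreover have "increments (X (Suc k)) u \<in> Rvec (N k)"
    by (simp add: increments_def topspace_Euclidean_space intervals_Suc)
  ultimately show ?thesis
    unfolding lift_polyhedron_def Let_def using eq mem by blast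
qed

text \<open>Nonemptiness and boundedness are propagated together, before any radius is used, since
  they make \<open>meb\<close> meaningful.\<close>

lemma polyhedron_mem_enclosed:
  "increments (X k) u \<in> P k 0 \<and> (\<exists>c\<in>Rvec (N k - 1). \<exists>\<rho>. P k 0 \<subseteq> eball (N k - 1) c \<rho>)"
proof (induction k)
  case 0
  have "(\<lambda>_. 0) \<in> Rvec (N 0 - 1)" by (simp add: topspace_Euclidean_space)
  moreover have "P 0 0 = initial_polyhedron L (X 0)" using run by (simp add: cpm_run_def)
  ultimately show ?case using initial_polyhedron_enclosed u0 by metis
next
  case (Suc k)
  obtain j where j: "j < N k" "mesh (X k) = glen (X k) j"
    and X': "X (Suc k) = insert ((gpoint (X k) j + gpoint (X k) (Suc j)) / 2) (X k)"
    and P': "P (Suc k) 0 = lift_polyhedron L (X k) j (P k (M k))"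
    using refinement[of k] .
  from Suc obtain c \<rho> where "P k (M k) \<subseteq> eball (N k - 1) c \<rho>"
    using inner_iterations(2)[of k "M k"] by blast
  from lift_polyhedron_enclosed[OF j(1) this, of L] obtain c'
    where "c' \<in> Rvec (N k)" "P (Suc k) 0 \<subseteq> eball (N k) c' (\<rho> + L * mesh (X k) / 2)"
    unfolding P' by blast
  moreover have "increments (X (Suc k)) u \<in> P (Suc k) 0"
    unfolding P' by (rule lift_mem[OF j refl X']) (use Suc inner_iterations(1) in auto)
  moreover have "N (Suc k) - 1 = N k" by (simp add: intervals_Suc)
  ultimately show ?case by metis
qed

lemma polyhedron_meb:
  assumes "j \<le> M k"
  shows "is_meb (N k - 1) (P k j) (meb_center (N k - 1) (P k j)) (meb_radius (N k - 1) (P k j))"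
proof -
  obtain c \<rho> where mem: "increments (X k) u \<in> P k 0" and c: "c \<in> Rvec (N k - 1)"
    and \<rho>: "P k 0 \<subseteq> eball (N k - 1) c \<rho>"
    using polyhedron_mem_enclosed[of k] by blast
  have "P k j \<noteq> {}" "P k j \<subseteq> eball (N k - 1) c \<rho>"
    using inner_iterations[OF mem assms] \<rho> by auto
  then show ?thesis using is_meb_meb c by blast
qed

lemma radius_nonneg: "0 \<le> r k"
  using polyhedron_meb[of 0 k] by (simp add: is_meb_def)

text \<open>The inner iterations shrink the radius by the factor \<open>\<epsilon>\<close>; the lift
  adds at most \<open>L * mesh (X k) / 2\<close>, relaxed here to
  \<open>L * mesh (X k)\<close>.\<close>

lemma radius_Suc: "r (Suc k) \<le> \<epsilon> * r k + L * mesh (X k)"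
proof -
  obtain j where j: "j < N k" and P': "P (Suc k) 0 = lift_polyhedron L (X k) j (P k (M k))"
    using refinement[of k] .
  let ?\<rho> = "meb_radius (N k - 1) (P k (M k))"
  have meb: "is_meb (N k - 1) (P k (M k)) (meb_center (N k - 1) (P k (M k))) ?\<rho>"
    by (rule polyhedron_meb) simp
  then have "P k (M k) \<subseteq> eball (N k - 1) (meb_center (N k - 1) (P k (M k))) ?\<rho>" and "0 \<le> ?\<rho>"
    by (auto simp: is_meb_def)
  from lift_polyhedron_enclosed[OF j this(1), of L] obtain c'
    where c': "c' \<in> Rvec (N k)" "P (Suc k) 0 \<subseteq> eball (N k) c' (?\<rho> + L * mesh (X k) / 2)"
    unfolding P' by blast
  have h: "0 < L * mesh (X k)" using L mesh_pos[OF grid] by simp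
  have "is_meb (N k) (P (Suc k) 0) (meb_center (N k) (P (Suc k) 0)) (r (Suc k))"
    using polyhedron_meb[of 0 "Suc k"] by (simp add: intervals_Suc)
  then have "r (Suc k) \<le> ?\<rho> + L * mesh (X k) / 2"
    unfolding is_meb_def using c' h \<open>0 \<le> ?\<rho>\<close> by auto
  also have "\<dots> \<le> \<epsilon> * r k + L * mesh (X k)"
    using run h unfolding cpm_run_def by (intro add_mono) auto
  finally show ?thesis .
qed

lemma radius_le: "r k \<le> \<epsilon> ^ k * r 0 + L * (\<Sum>i<k. \<epsilon> ^ i * mesh (X (k - 1 - i)))"
proof (induction k)
  case (Suc k)
  have "r (Suc k) \<le> \<epsilon> * (\<epsilon> ^ k * r 0 + L * (\<Sum>i<k. \<epsilon> ^ i * mesh (X (k - 1 - i)))) + L * mesh (X k)"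
    using radius_Suc[of k] mult_left_mono[OF Suc, of \<epsilon>] \<epsilon> by linarith
  \<comment> \<open>Multiplication by \<open>\<epsilon>\<close> moves old term \<open>i\<close> to
    \<open>i + 1\<close>; the current mesh becomes term 0.\<close>
  also have "\<dots> = \<epsilon> ^ Suc k * r 0 + L * (\<Sum>i<Suc k. \<epsilon> ^ i * mesh (X (Suc k - 1 - i)))"
    by (subst sum.lessThan_Suc_shift) (simp add: sum_distrib_left algebra_simps)
  finally show ?case .
qed simp

lemma sup_dist_le:
  assumes "v \<in> ambiguity_set a b L (X k) (P k 0)"
  shows "sup_dist a b u v \<le> L * mesh (X k) / 2 + 2 * sqrt (real (N k) - 1) * r k"
proof (rule sup_dist_le_of_increments[OF grid u])
  have "P k 0 \<subseteq> eball (N k - 1) (meb_center (N k - 1) (P k 0)) (r k)"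
    using polyhedron_meb[of 0 k] by (simp add: is_meb_def)
  then show "increments (X k) u \<in> eball (N k - 1) (meb_center (N k - 1) (P k 0)) (r k)"
    "increments (X k) v \<in> eball (N k - 1) (meb_center (N k - 1) (P k 0)) (r k)"
    using assms polyhedron_mem_enclosed[of k] by (auto simp: ambiguity_set_def)
qed (use assms in \<open>simp add: ambiguity_set_def\<close>)

section \<open>Decay of the mesh under bisection\<close>

lemma glen_Suc:
  obtains j where "j < N k"
    "\<And>i. i \<le> N k \<Longrightarrow> glen (X (Suc k)) i = split_component j (mesh (X k) / 2) (glen (X k)) i"
    "mesh (X k) = glen (X k) j"
proof -
  obtain j where j: "j < N k" "mesh (X k) = glen (X k) j"
    and X': "X (Suc k) = insert ((gpoint (X k) j + gpoint (X k) (Suc j)) / 2) (X k)"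
    using refinement[of k] .
  have "glen (X (Suc k)) i = split_component j (mesh (X k) / 2) (glen (X k)) i" if "i \<le> N k" for i
    \<comment> \<open>Interval lengths are the increments of the identity.\<close>
    using increments_insert[OF grid j(1) midpoint_between[OF grid j(1)] that, of "\<lambda>x. x"] j
    by (auto simp: X' glen_def split_component_def field_simps)
  with j that show ?thesis by blast
qed

lemma mesh_Suc_le: "mesh (X (Suc k)) \<le> mesh (X k)"
proof -
  obtain j where j: "j < N k" "mesh (X k) = glen (X k) j"
    and gl: "\<And>i. i \<le> N k \<Longrightarrow> glen (X (Suc k)) i = split_component j (mesh (X k) / 2) (glen (X k)) i"
    using glen_Suc[of k] by metis
  have "glen (X (Suc k)) i \<le> mesh (X k)" if "i < N (Suc k)" for i
    using that gl[of i] j glen_le_mesh[OF grid, of i k] glen_le_mesh[OF grid, of "i - 1" k]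
      mesh_pos[OF grid, of k]
    by (auto simp: intervals_Suc split_component_def)
  then show ?thesis
    using intervals_Suc[of k] by (subst mesh_def) (auto intro!: Max.boundedI)
qed

text \<open>Both halves of a bisected longest interval have length at least half of every later mesh
  size, so short intervals can only come from the initial grid.\<close>

lemma glen_quasiuniform: "\<exists>\<kappa>>0. \<forall>k. \<forall>i<N k. \<kappa> * mesh (X k) \<le> glen (X k) i"
proof -
  define m where "m = Min (glen (X 0) ` {..<N 0})"
  \<comment> \<open>The first entry covers the initial grid, the second the two halves of a bisected
    interval.\<close>
  define \<kappa> where "\<kappa> = min (m / mesh (X 0)) (1 / 2)"
  have "N 0 \<noteq> 0" using intervals_pos[OF grid[of 0]] by simp
  then have "m \<in> glen (X 0) ` {..<N 0}" unfolding m_def by (intro Min_in) auto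
  then have m: "0 < m" "\<And>i. i < N 0 \<Longrightarrow> m \<le> glen (X 0) i"
    using glen_pos[OF grid[of 0]] by (auto simp: m_def)
  have "\<kappa> * mesh (X k) \<le> glen (X k) i" if "i < N k" for k i
    using that
  proof (induction k arbitrary: i)
    case 0
    have "\<kappa> * mesh (X 0) \<le> m / mesh (X 0) * mesh (X 0)"
      using mesh_pos[OF grid, of 0] by (intro mult_right_mono) (auto simp: \<kappa>_def)
    then show ?case using m(2)[OF 0] mesh_pos[OF grid, of 0] by simp
  next
    case (Suc k)
    obtain j where j: "j < N k" "mesh (X k) = glen (X k) j"
      and gl: "\<And>i. i \<le> N k \<Longrightarrow> glen (X (Suc k)) i = split_component j (mesh (X k) / 2) (glen (X k)) i"
      using glen_Suc[of k] by metis
    have half: "\<kappa> * mesh (X k) \<le> mesh (X k) / 2"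
    proof -
      have "\<kappa> \<le> 1 / 2" unfolding \<kappa>_def by (rule min.cobounded2)
      then have "\<kappa> * mesh (X k) \<le> 1 / 2 * mesh (X k)"
        using mesh_pos[OF grid, of k] by (intro mult_right_mono) auto
      then show ?thesis by simp
    qed
    have "0 < \<kappa>" using m(1) mesh_pos[OF grid, of 0] by (simp add: \<kappa>_def)
    then have "\<kappa> * mesh (X (Suc k)) \<le> \<kappa> * mesh (X k)"
      using mesh_Suc_le[of k] by (intro mult_left_mono) auto
    also have "\<dots> \<le> glen (X (Suc k)) i"
      \<comment> \<open>Cells left of the split keep their index and those right of it shift by one,
        hence the two instances of the induction hypothesis.\<close>
      using Suc.prems gl[of i] j half Suc.IH[of i] Suc.IH[of "i - 1"]
      by (auto simp: intervals_Suc split_component_def)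
    finally show ?case .
  qed
  moreover have "0 < \<kappa>" using m(1) mesh_pos[OF grid, of 0] by (simp add: \<kappa>_def)
  ultimately show ?thesis by blast
qed

lemma mesh_harmonic: "\<exists>C. \<forall>k. mesh (X k) \<le> C / (real k + 1)"
proof -
  obtain \<kappa> where \<kappa>: "\<kappa> > 0" "\<And>k i. i < N k \<Longrightarrow> \<kappa> * mesh (X k) \<le> glen (X k) i"
    using glen_quasiuniform by blast
  have "mesh (X k) \<le> (b - a) / \<kappa> / (real k + 1)" for k
  proof -
    have "mesh (X k) \<le> (b - a) / \<kappa> / real (N k)"
      by (rule mesh_le_of_quasiuniform[OF grid \<kappa>])
    \<comment> \<open>Each round adds one interval to at least one, so \<open>N k\<close> is at
      least \<open>k + 1\<close>.\<close>
    also have "\<dots> \<le> (b - a) / \<kappa> / (real k + 1)"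
      using intervals_eq[of k] intervals_pos[OF grid[of 0]] \<kappa>(1) grid_less[OF grid[of 0]]
      by (intro divide_left_mono) auto
    finally show ?thesis .
  qed
  then show ?thesis by blast
qed

section \<open>Convergence of the error bound\<close>

lemma error_bound_tendsto:
  "(\<lambda>k. L * mesh (X k) / 2 + 2 * sqrt (real (N k) - 1) * r k) \<longlonglongrightarrow> 0"
proof -
  obtain C where C: "\<And>k. mesh (X k) \<le> C / (real k + 1)" using mesh_harmonic by blast
  have "0 \<le> C" using C[of 0] mesh_pos[OF grid, of 0] by simp
  \<comment> \<open>The mesh bound turns the radius recurrence into a contraction with harmonic
    forcing.\<close>
  have "r (Suc k) \<le> \<epsilon> * r k + L * C / (real k + 1)" for k
    using radius_Suc[of k] mult_left_mono[OF C[of k], of L] L by simp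
  then obtain D where D: "\<And>k. r k \<le> D / (real k + 1)"
    using contraction_with_harmonic_forcing[OF \<epsilon>, of "L * C" r] L \<open>0 \<le> C\<close> by auto
  have n: "real (N k) - 1 = real (N 0 - 1) + real k" for k
    using intervals_eq[of k] intervals_pos[OF grid[of 0]] by simp
  show ?thesis
  proof (rule tendsto_sandwich[OF _ _ tendsto_const])
    show "\<forall>\<^sub>F k in sequentially. 0 \<le> L * mesh (X k) / 2 + 2 * sqrt (real (N k) - 1) * r k"
      using L mesh_pos[OF grid] radius_nonneg
      by (intro always_eventually allI add_nonneg_nonneg mult_nonneg_nonneg divide_nonneg_nonneg)
        (auto simp: less_imp_le n)
    show "\<forall>\<^sub>F k in sequentially. L * mesh (X k) / 2 + 2 * sqrt (real (N k) - 1) * r k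
        \<le> L * (C / (real k + 1)) / 2 + 2 * sqrt (real (N 0 - 1) + real k) * (D / (real k + 1))"
      unfolding n using L C D
      by (intro always_eventually allI add_mono mult_left_mono divide_right_mono) auto
    show "(\<lambda>k. L * (C / (real k + 1)) / 2 + 2 * sqrt (real (N 0 - 1) + real k) * (D / (real k + 1))) \<longlonglongrightarrow> 0"
      by real_asymp
  qed
qed

lemma sup_dist_uniform_tendsto:
  "(\<lambda>k. SUP v \<in> ambiguity_set a b L (X k) (P k 0). sup_dist a b v u) \<longlonglongrightarrow> 0"
proof (rule tendsto_sandwich[OF _ _ tendsto_const error_bound_tendsto])
  let ?S = "\<lambda>k. SUP v \<in> ambiguity_set a b L (X k) (P k 0). sup_dist a b v u"
  have S: "?S k = (SUP v \<in> ambiguity_set a b L (X k) (P k 0). sup_dist a b u v)" for k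
    by (simp add: sup_dist_def abs_minus_commute)
  \<comment> \<open>The true utility keeps the set nonempty, so the supremum is a genuine one, and
    its distance 0 to itself bounds it below.\<close>
  have mem: "u \<in> ambiguity_set a b L (X k) (P k 0)" for k
    using u polyhedron_mem_enclosed[of k] by (simp add: ambiguity_set_def)
  show "\<forall>\<^sub>F k in sequentially. ?S k \<le> L * mesh (X k) / 2 + 2 * sqrt (real (N k) - 1) * r k"
    unfolding S by (intro always_eventually allI cSUP_least sup_dist_le) (use mem in auto)
  have bdd: "bdd_above (sup_dist a b u ` ambiguity_set a b L (X k) (P k 0))" for k
    using sup_dist_le[of _ k] by (meson bdd_above.I2)
  have "sup_dist a b u u = 0"
    using grid_less[OF grid[of 0]] by (simp add: sup_dist_def)
  then have "0 \<le> ?S k" for k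
    unfolding S using cSUP_upper[OF mem bdd, of k] by simp
  then show "\<forall>\<^sub>F k in sequentially. 0 \<le> ?S k" by simp
qed

end

theorem theorem5p2:
  fixes a b L \<epsilon> \<delta> :: real
    and ustar :: "real \<Rightarrow> real"
    and X :: "nat \<Rightarrow> real set"
    and M :: "nat \<Rightarrow> nat"
    and P :: "nat \<Rightarrow> nat \<Rightarrow> (nat \<Rightarrow> real) set"
    and N :: "nat \<Rightarrow> nat"
    and h r :: "nat \<Rightarrow> real"
    and U :: "nat \<Rightarrow> (real \<Rightarrow> real) set"
  assumes "L > 0" and "0 < \<epsilon>" and "\<epsilon> < 1"
    and run: "cpm_run a b L \<epsilon> ustar X M P"
    and \<delta>: "\<delta> = b - a"
    and N: "\<And>k. N k = intervals (X k)"
    and h: "\<And>k. h k = mesh (X k)"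
    and r: "\<And>k. r k = meb_radius (N k - 1) (P k 0)"
    and U: "\<And>k. U k = ambiguity_set a b L (X k) (P k 0)"
    and ustar: "ustar \<in> U 0"
  shows "(\<forall>k. \<forall>u \<in> U k.
            kantorovich_dist a b ustar u \<le> kolmogorov_dist a b ustar u \<and>
            kolmogorov_dist a b ustar u
              \<le> \<delta> * L * h k / 2 + 2 * \<delta> * sqrt (real (N k) - 1) * r k \<and>
            \<delta> * L * h k / 2 + 2 * \<delta> * sqrt (real (N k) - 1) * r k
              \<le> \<delta> * L * h k / 2 + 2 * \<delta> * sqrt (real (N k) - 1) *
                  (\<epsilon> ^ k * r 0 + L * (\<Sum>i<k. \<epsilon> ^ i * h (k - 1 - i)))) \<and>
         (\<lambda>k. SUP u \<in> U k. sup_dist a b u ustar) \<longlonglongrightarrow> 0"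
proof -
  have ustar': "ustar \<in> utilities a b L" "increments (X 0) ustar \<in> P 0 0"
    using ustar unfolding U ambiguity_set_def by blast+
  interpret cpm a b L \<epsilon> ustar X M P
    by (rule cpm.intro[OF assms(1-4) ustar'])
  have \<delta>0: "0 < \<delta>" using grid_less[OF grid[of 0]] \<delta> by simp
  have "kantorovich_dist a b ustar v \<le> kolmogorov_dist a b ustar v"
    if "v \<in> U k" for k v
    using that kantorovich_le_kolmogorov[OF grid_less[OF grid] u] by (simp add: U ambiguity_set_def)
  moreover have "kolmogorov_dist a b ustar v
      \<le> \<delta> * L * h k / 2 + 2 * \<delta> * sqrt (real (N k) - 1) * r k" if "v \<in> U k" for k v
  proof -
    have "sup_dist a b ustar v \<le> L * h k / 2 + 2 * sqrt (real (N k) - 1) * r k"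
      using that sup_dist_le[of v k] by (simp add: assms(6-9))
    then have "\<delta> * sup_dist a b ustar v \<le> \<delta> * (L * h k / 2 + 2 * sqrt (real (N k) - 1) * r k)"
      using \<delta>0 by (intro mult_left_mono) auto
    then show ?thesis by (simp add: kolmogorov_dist_def \<delta> algebra_simps)
  qed
  \<comment> \<open>The final bound differs only in the radius, so the unrolled recurrence is scaled
    by a nonnegative factor.\<close>
  moreover have "2 * \<delta> * sqrt (real (N k) - 1) * r k \<le> 2 * \<delta> * sqrt (real (N k) - 1) *
      (\<epsilon> ^ k * r 0 + L * (\<Sum>i<k. \<epsilon> ^ i * h (k - 1 - i)))" for k
  proof (rule mult_left_mono)
    show "r k \<le> \<epsilon> ^ k * r 0 + L * (\<Sum>i<k. \<epsilon> ^ i * h (k - 1 - i))"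
      using radius_le[of k] by (simp add: assms(6-8))
    show "0 \<le> 2 * \<delta> * sqrt (real (N k) - 1)"
      using \<delta>0 intervals_pos[OF grid[of k]] by (simp add: N)
  qed
  moreover have "(\<lambda>k. SUP u \<in> U k. sup_dist a b u ustar) \<longlonglongrightarrow> 0"
    using sup_dist_uniform_tendsto by (simp add: U)
  ultimately show ?thesis by simp
qed

end
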